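(* Let $H:\mathbb{R}^2\to\mathbb{R}$ be \[ H(p)=\frac{3^3}{4^4}\,p_1^4+p_2^2,\qquad p=(p_1,p_2)\in\mathbb{R}^2 . \] Then $H$ is smooth, strictly convex and coercive (i.e. $\lim_{|p|\to\infty}H(p)/|p|=+\infty$), but it is not uniformly directionally convex, i.e. it is not true that for every $r>0$ \[ \inf_{p\ne q\in\overline B(0,r)}\left\langle \frac{DH(p)-DH(q)}{|DH(p)-DH(q)|},\frac{p-q}{|p-q|}\right\rangle>0 , \] and there exists a Lipschitz function $u_0:\mathbb{R}^2\to\mathbb{R}$ such that, if $u$ is the viscosity solution of $u_t+H(D_xu)=0$ on $(0,\infty)\times\mathbb{R}^2$ with $u(0,\cdot)=u_0$, then both $D_xu(1,\cdot)$ and $\mathbf{b}(1,\cdot)=DH(D_xu(1,\cdot))$ fail to have locally bounded variation on $\mathbb{R}^2$.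
   Context: The viscosity solution is given by the Hopf-Lax formula $u(t,x)=\min_{y\in\mathbb{R}^2}\{u_0(y)+tL((x-y)/t)\}$, $t>0$, where $L(q)=\max_{p\in\mathbb{R}^2}\{\langle p,q\rangle-H(p)\}$ is the Legendre transform of $H$. The function $u(1,\cdot)$ is Lipschitz, so $D_xu(1,\cdot)$ and $DH(D_xu(1,\cdot))$ are defined almost everywhere and belong to $\mathbf{L}^\infty(\mathbb{R}^2;\mathbb{R}^2)$. A function has locally bounded variation if its distributional derivative is a (matrix-valued) Radon measure, i.e. it has finite total variation on every bounded open set. *)

theory Defs
  imports "HOL-Analysis.Analysis"
begin

text \<open>Differentiability of order \<open>k\<close> (intended for open \<open>S\<close>): all iterated
  directional derivatives up to order \<open>k\<close> exist and are continuous.\<close>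

primrec Ck_on :: "nat \<Rightarrow> ('a::real_normed_vector \<Rightarrow> real) \<Rightarrow> 'a set \<Rightarrow> bool" where
  "Ck_on 0 f S \<longleftrightarrow> continuous_on S f"
| "Ck_on (Suc k) f S \<longleftrightarrow> (\<forall>x\<in>S. f differentiable (at x)) \<and>
     (\<forall>v. Ck_on k (\<lambda>x. frechet_derivative f (at x) v) S)"

definition smooth :: "('a::real_normed_vector \<Rightarrow> real) \<Rightarrow> bool" where
  "smooth f \<longleftrightarrow> (\<forall>k. Ck_on k f UNIV)"

definition strictly_convex :: "('a::real_vector \<Rightarrow> real) \<Rightarrow> bool" where
  "strictly_convex f \<longleftrightarrow> (\<forall>x y t. x \<noteq> y \<longrightarrow> 0 < t \<longrightarrow> t < 1 \<longrightarrow>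
     f ((1 - t) *\<^sub>R x + t *\<^sub>R y) < (1 - t) * f x + t * f y)"

definition coercive :: "('a::real_normed_vector \<Rightarrow> real) \<Rightarrow> bool" where
  "coercive f \<longleftrightarrow> filterlim (\<lambda>p. f p / norm p) at_top at_infinity"

text \<open>At points where \<open>f\<close> is not differentiable, \<open>grad f\<close> has an unspecified value; below it
  is only used for almost everywhere differentiable functions and up to null sets.\<close>

definition grad :: "('a::real_inner \<Rightarrow> real) \<Rightarrow> 'a \<Rightarrow> 'a" where
  "grad f x = (THE D. GDERIV f x :> D)"

definition uniformly_directionally_convex :: "('a::real_inner \<Rightarrow> real) \<Rightarrow> bool" where
  "uniformly_directionally_convex f \<longleftrightarrow> (\<forall>r>0.
     (INF (p, q) \<in> {(p, q). p \<in> cball 0 r \<and> q \<in> cball 0 r \<and> p \<noteq> q}.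
        ((grad f p - grad f q) /\<^sub>R norm (grad f p - grad f q)) \<bullet>
        ((p - q) /\<^sub>R norm (p - q))) > 0)"

definition legendre :: "('a::real_inner \<Rightarrow> real) \<Rightarrow> 'a \<Rightarrow> real" where
  "legendre H q = (SUP p. p \<bullet> q - H p)"

definition hopf_lax :: "('a::real_inner \<Rightarrow> real) \<Rightarrow> ('a \<Rightarrow> real) \<Rightarrow> real \<Rightarrow> 'a \<Rightarrow> real" where
  "hopf_lax H u0 t x =
     (if t = 0 then u0 x else (INF y. u0 y + t * legendre H ((x - y) /\<^sub>R t)))"

text \<open>Crandall--Lions viscosity solutions of \<open>u\<^sub>t + H(D\<^sub>x u) = 0\<close> on \<open>(0,\<infinity>) \<times> 'a\<close>.\<close>

definition viscosity_subsolution ::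
    "('a::real_inner \<Rightarrow> real) \<Rightarrow> (real \<Rightarrow> 'a \<Rightarrow> real) \<Rightarrow> bool" where
  "viscosity_subsolution H u \<longleftrightarrow>
     (\<forall>\<phi> t x. t > 0 \<longrightarrow> Ck_on 1 (\<lambda>(s, y). \<phi> s y) ({0<..} \<times> UNIV) \<longrightarrow>
        (\<forall>\<^sub>F (s, y) in nhds (t, x). u s y - \<phi> s y \<le> u t x - \<phi> t x) \<longrightarrow>
        deriv (\<lambda>s. \<phi> s x) t + H (grad (\<phi> t) x) \<le> 0)"

definition viscosity_supersolution ::
    "('a::real_inner \<Rightarrow> real) \<Rightarrow> (real \<Rightarrow> 'a \<Rightarrow> real) \<Rightarrow> bool" where
  "viscosity_supersolution H u \<longleftrightarrow>
     (\<forall>\<phi> t x. t > 0 \<longrightarrow> Ck_on 1 (\<lambda>(s, y). \<phi> s y) ({0<..} \<times> UNIV) \<longrightarrow>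
        (\<forall>\<^sub>F (s, y) in nhds (t, x). u s y - \<phi> s y \<ge> u t x - \<phi> t x) \<longrightarrow>
        deriv (\<lambda>s. \<phi> s x) t + H (grad (\<phi> t) x) \<ge> 0)"

definition viscosity_solution ::
    "('a::real_inner \<Rightarrow> real) \<Rightarrow> ('a \<Rightarrow> real) \<Rightarrow> (real \<Rightarrow> 'a \<Rightarrow> real) \<Rightarrow> bool" where
  "viscosity_solution H u0 u \<longleftrightarrow>
     continuous_on ({0..} \<times> UNIV) (\<lambda>(t, x). u t x) \<and> u 0 = u0 \<and>
     viscosity_subsolution H u \<and> viscosity_supersolution H u"

definition test_function :: "('a::real_normed_vector \<Rightarrow> real) \<Rightarrow> bool" where
  "test_function \<phi> \<longleftrightarrow> smooth \<phi> \<and> compact (closure {x. \<phi> x \<noteq> 0})"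

definition radon_measure :: "'a::topological_space measure \<Rightarrow> bool" where
  "radon_measure \<mu> \<longleftrightarrow> sets \<mu> = sets borel \<and> (\<forall>K. compact K \<longrightarrow> emeasure \<mu> K < \<infinity>)"

text \<open>A signed Radon measure is a difference of two positive ones. Neither need be finite on
  the whole space, so it is given by the pair \<open>(\<mu>, \<nu>)\<close>. The matrix-valued measure \<open>Df\<close>
  is described by its entries \<open>D\<^sub>j f\<^sub>i\<close>. Integration is with respect to \<open>lebesgue\<close>,
  which makes the notion insensitive to changes of \<open>f\<close> on null sets.\<close>

definition locally_BV :: "(real^'n \<Rightarrow> real^'m) \<Rightarrow> bool" where
  "locally_BV f \<longleftrightarrow>
     (\<forall>K. compact K \<longrightarrow> f absolutely_integrable_on K) \<and>
     (\<forall>i j. \<exists>\<mu> \<nu>. radon_measure \<mu> \<and> radon_measure \<nu> \<and>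
        (\<forall>\<phi>. test_function \<phi> \<longrightarrow>
           (LINT x|lebesgue. f x $ i * frechet_derivative \<phi> (at x) (axis j 1)) =
           - ((LINT x|\<mu>. \<phi> x) - (LINT x|\<nu>. \<phi> x))))"

end

theory Submission
  imports Defs
begin

text \<open>
  The Legendre transform of \<open>H\<close> is \<open>L(q) = |q\<^sub>1|\<close> to the power \<open>4/3\<close> plus \<open>q\<^sub>2\<^sup>2 / 4\<close>. For a
  datum \<open>min (v(y\<^sub>1)) (w(y\<^sub>2))\<close> the Hopf--Lax formula decouples into the minimum of two
  one-dimensional inf-convolutions. With \<open>v\<close>, \<open>w\<close> multiples of the distances to closed sets
  \<open>A\<close>, \<open>B\<close> whose gaps have length at most \<open>1\<close>, the solution at time \<open>1\<close> is the minimum of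
  \<open>dist(x\<^sub>1, A)\<close> to the power \<open>4/3\<close> and \<open>dist(x\<^sub>2, B)\<^sup>2 / 4\<close> (\<open>hopf_lax_grid_datum\<close>).

  In a grid rectangle of width \<open>a = e\<^sup>3\<close> and height \<open>h = e\<^sup>2\<close> both terms are of the same size.
  They agree along curves in the rectangle, across which the second component
  of the gradient jumps by a quantity of order \<open>h\<close>. Hence \<open>D\<^sub>1 D\<^sub>2 u\<close> has mass of order
  \<open>h\<^sup>2 = e\<close> to the fourth in each rectangle (\<open>integral_cell\<close>), whereas the area of the rectangle
  is \<open>e\<close> to the fifth: the mass per unit area is unbounded as \<open>e\<close> tends to \<open>0\<close>. Combining the
  scales \<open>e = 1, 1/8, 1/64, \<dots>\<close>, the \<open>n\<close>-th one filling a square of side \<open>2\<close> to the power \<open>-n\<close>,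
  gives infinite mass in a bounded set (\<open>not_locally_BV_if_cells\<close>). Since
  \<open>(DH(p))\<^sub>2 = 2 p\<^sub>2\<close>, the same computation disposes of both \<open>Du\<close> and \<open>DH(Du)\<close>.

  That the Hopf--Lax formula defines a viscosity solution is proved for all continuous coercive
  convex Hamiltonians and Lipschitz data (\<open>hopf_lax_viscosity_solution\<close>), from the semigroup
  property of the formula. Uniform directional convexity fails because the increment of \<open>DH\<close>
  from \<open>0\<close> to \<open>(s, s\<^sup>2)\<close> becomes orthogonal to \<open>(s, s\<^sup>2)\<close> as \<open>s\<close> tends to \<open>0\<close>.
\<close>

section \<open>Smooth functions\<close>

lemma smooth_if_closed_under_derivatives:
  fixes f :: "'a::real_normed_vector \<Rightarrow> real"
  assumes "f \<in> A"
    and closed: "\<And>g. g \<in> A \<Longrightarrow>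
      \<exists>g'. (\<forall>x. (g has_derivative g' x) (at x)) \<and> (\<forall>v. (\<lambda>x. g' x v) \<in> A)"
  shows "smooth f"
proof -
  have "Ck_on k g UNIV" if "g \<in> A" for k g
    using that
  proof (induction k arbitrary: g)
    case 0
    then obtain g' where "\<And>x. (g has_derivative g' x) (at x)"
      using closed by blast
    then show ?case
      by (auto intro!: continuous_at_imp_continuous_on has_derivative_continuous)
  next
    case (Suc k)
    then obtain g' where g': "\<And>x. (g has_derivative g' x) (at x)" "\<And>v. (\<lambda>x. g' x v) \<in> A"
      using closed by blast
    then have "frechet_derivative g (at x) = g' x" for x
      by (metis frechet_derivative_at)
    then show ?case
      using g' Suc.IH by (auto simp: differentiable_def)
  qed
  with \<open>f \<in> A\<close> show ?thesis
    by (simp add: smooth_def)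
qed

text \<open>The functions \<open>p(1/t) exp(-1/t)\<close>, extended by \<open>0\<close> to \<open>t \<le> 0\<close>. Taking all
  polynomials \<open>p\<close> at once makes the family closed under differentiation.\<close>

definition flat :: "real poly \<Rightarrow> real \<Rightarrow> real" where
  "flat p t = (if t > 0 then poly p (1 / t) * exp (- (1 / t)) else 0)"

lemma poly_times_exp_minus_tendsto_0:
  "((\<lambda>s. poly p s * exp (- s)) \<longlongrightarrow> (0::real)) at_top"
proof -
  have "((\<lambda>s::real. \<Sum>i\<le>degree p. coeff p i * (s ^ i / exp s)) \<longlongrightarrow> (\<Sum>i\<le>degree p. coeff p i * 0)) at_top"
    by (intro tendsto_intros tendsto_power_div_exp_0)
  moreover have "(\<Sum>i\<le>degree p. coeff p i * (s ^ i / exp s)) = poly p s * exp (- s)" for s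
    by (simp add: poly_altdef exp_minus sum_distrib_right sum_distrib_left divide_inverse mult_ac)
  ultimately show ?thesis by simp
qed

lemma has_derivative_flat:
  "(flat p has_real_derivative flat ([:0, 0, 1:] * (p - pderiv p)) t) (at t)"
proof (cases t "0::real" rule: linorder_cases)
  case greater
  have "((\<lambda>t. poly p (1 / t) * exp (- (1 / t))) has_real_derivative
      flat ([:0, 0, 1:] * (p - pderiv p)) t) (at t)"
    using greater
    by (auto intro!: derivative_eq_intros simp: flat_def field_simps power2_eq_square)
  moreover have "\<forall>\<^sub>F s in nhds t. poly p (1 / s) * exp (- (1 / s)) = flat p s"
    using eventually_nhds_in_open[of "{0<..}" t] greater
    by (auto simp: flat_def elim!: eventually_mono)
  ultimately show ?thesis
    by (subst (asm) DERIV_cong_ev[OF refl _ refl]) auto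
next
  case less
  have "\<forall>\<^sub>F s in nhds t. flat p s = 0"
    using eventually_nhds_in_open[of "{..<0}" t] less
    by (auto simp: flat_def elim!: eventually_mono)
  then show ?thesis
    using less by (subst DERIV_cong_ev[OF refl _ refl, of _ "\<lambda>_. 0"]) (auto simp: flat_def)
next
  case equal
  have "((\<lambda>s. flat p s / s) \<longlongrightarrow> 0) (at_left 0)"
    by (rule tendsto_eventually) (auto simp: flat_def eventually_at_left_field intro!: exI[of _ "-1"])
  moreover have "((\<lambda>s. flat p s / s) \<longlongrightarrow> 0) (at_right 0)"
  proof -
    have "((\<lambda>s. poly ([:0, 1:] * p) (inverse s) * exp (- inverse s)) \<longlongrightarrow> (0::real)) (at_right 0)"
      by (rule filterlim_compose[OF poly_times_exp_minus_tendsto_0 filterlim_inverse_at_top_right])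
    moreover have "\<forall>\<^sub>F s in at_right 0.
        poly ([:0, 1:] * p) (inverse s) * exp (- inverse s) = flat p s / s"
      by (auto simp: flat_def eventually_at_right_field field_simps intro!: exI[of _ 1])
    ultimately show ?thesis
      by (rule Lim_transform_eventually)
  qed
  ultimately have "((\<lambda>s. flat p s / s) \<longlongrightarrow> 0) (at 0)"
    by (simp add: filterlim_at_split)
  then show ?thesis
    using equal by (simp add: has_field_derivative_iff flat_def)
qed

text \<open>An algebra of functions that contains polynomials and bump functions and is closed under
  directional derivatives, so that membership alone yields smoothness.\<close>

inductive_set smooth_algebra :: "('a::real_normed_vector \<Rightarrow> real) set" where
  const: "(\<lambda>_. c) \<in> smooth_algebra"
| linear: "bounded_linear f \<Longrightarrow> f \<in> smooth_algebra"
| add: "f \<in> smooth_algebra \<Longrightarrow> g \<in> smooth_algebra \<Longrightarrow> (\<lambda>x. f x + g x) \<in> smooth_algebra"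
| mult: "f \<in> smooth_algebra \<Longrightarrow> g \<in> smooth_algebra \<Longrightarrow> (\<lambda>x. f x * g x) \<in> smooth_algebra"
| flat: "f \<in> smooth_algebra \<Longrightarrow> (\<lambda>x. flat p (f x)) \<in> smooth_algebra"

lemma smooth_algebra_smooth:
  assumes "f \<in> smooth_algebra"
  shows "smooth f"
  using assms
proof (rule smooth_if_closed_under_derivatives)
  fix g :: "'a \<Rightarrow> real"
  assume "g \<in> smooth_algebra"
  then show "\<exists>g'. (\<forall>x. (g has_derivative g' x) (at x)) \<and> (\<forall>v. (\<lambda>x. g' x v) \<in> smooth_algebra)"
  proof induction
    case (const c)
    show ?case
      by (rule exI[of _ "\<lambda>_ _. 0"]) (auto intro: smooth_algebra.const)
  next
    case (linear f)
    then show ?case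
      by (intro exI[of _ "\<lambda>_. f"]) (auto intro: smooth_algebra.const bounded_linear_imp_has_derivative)
  next
    case (add f g)
    then obtain f' g' where
      "\<forall>x. (f has_derivative f' x) (at x)" "\<forall>v. (\<lambda>x. f' x v) \<in> smooth_algebra"
      "\<forall>x. (g has_derivative g' x) (at x)" "\<forall>v. (\<lambda>x. g' x v) \<in> smooth_algebra"
      by blast
    then show ?case
      by (intro exI[of _ "\<lambda>x v. f' x v + g' x v"])
        (auto intro: smooth_algebra.intros derivative_eq_intros)
  next
    case (mult f g)
    then obtain f' g' where
      "\<forall>x. (f has_derivative f' x) (at x)" "\<forall>v. (\<lambda>x. f' x v) \<in> smooth_algebra"
      "\<forall>x. (g has_derivative g' x) (at x)" "\<forall>v. (\<lambda>x. g' x v) \<in> smooth_algebra"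
      by blast
    with mult.hyps show ?case
      by (intro exI[of _ "\<lambda>x v. f x * g' x v + f' x v * g x"])
        (auto intro!: smooth_algebra.add smooth_algebra.mult has_derivative_mult)
  next
    case (flat f p)
    then obtain f' where f': "\<forall>x. (f has_derivative f' x) (at x)" "\<forall>v. (\<lambda>x. f' x v) \<in> smooth_algebra"
      by blast
    define q where "q = [:0, 0, 1:] * (p - pderiv p)"
    have "((\<lambda>x. flat p (f x)) has_derivative (\<lambda>v. flat q (f x) * f' x v)) (at x)" for x
      using has_derivative_compose[OF f'(1)[rule_format, of x]
          has_derivative_flat[of p "f x", unfolded has_field_derivative_def]]
      by (simp add: q_def)
    with f'(2) flat.hyps show ?case
      by (intro exI[of _ "\<lambda>x v. flat q (f x) * f' x v"]) (auto intro: smooth_algebra.intros)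
  qed
qed

section \<open>The Hopf--Lax formula defines a viscosity solution\<close>

lemma grad_eqI:
  assumes "GDERIV f x :> D"
  shows "grad f x = D"
  unfolding grad_def
proof (rule the_equality)
  fix D' assume "GDERIV f x :> D'"
  with assms have "(\<lambda>h. h \<bullet> D') = (\<lambda>h. h \<bullet> D)"
    unfolding gderiv_def by (rule has_derivative_unique[rotated])
  then have "\<forall>h. h \<bullet> D' = h \<bullet> D"
    by (simp add: fun_eq_iff)
  then show "D' = D"
    by (rule vector_eq_ldot[THEN iffD1])
qed (fact assms)

text \<open>Continuous coercive Hamiltonians with a subgradient at every point, i.e. convex ones. The
  subgradient is what makes every \<open>p\<close> optimal for some \<open>q\<close> in the Legendre transform.\<close>

locale convex_hamiltonian =
  fixes H :: "'a::euclidean_space \<Rightarrow> real"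
  assumes continuous: "continuous_on UNIV H"
    and coercive: "coercive H"
    and subgradient: "\<And>p. \<exists>q. \<forall>p'. H p' \<ge> H p + (p' - p) \<bullet> q"
begin

lemma bounded_on_cball: "\<exists>M. \<forall>p\<in>cball 0 r. \<bar>H p\<bar> \<le> M"
proof -
  have "compact (H ` cball 0 r)"
    using continuous by (intro compact_continuous_image) (auto intro: continuous_on_subset)
  then have "bounded (H ` cball 0 r)"
    by (rule compact_imp_bounded)
  then show ?thesis
    by (auto simp: bounded_iff)
qed

lemma bdd_above_legendre: "bdd_above (range (\<lambda>p. p \<bullet> q - H p))"
proof -
  obtain b where b: "\<And>p. norm p \<ge> b \<Longrightarrow> H p / norm p \<ge> norm q"
  proof -
    have "\<forall>\<^sub>F p in at_infinity. norm q \<le> H p / norm p"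
      using coercive unfolding coercive_def filterlim_at_top by (rule spec)
    then show ?thesis
      unfolding eventually_at_infinity using that by auto
  qed
  obtain M where M: "\<And>p. p \<in> cball 0 (max b 1) \<Longrightarrow> \<bar>H p\<bar> \<le> M"
    using bounded_on_cball by blast
  have "p \<bullet> q - H p \<le> max 0 (max b 1 * norm q + M)" for p
  proof (cases "norm p \<le> max b 1")
    case True
    have "p \<bullet> q \<le> norm p * norm q" by (rule norm_cauchy_schwarz)
    also have "\<dots> \<le> max b 1 * norm q" using True by (rule mult_right_mono) simp
    finally show ?thesis using M[of p] True by auto
  next
    case False
    then have "norm p > 0" "b \<le> norm p" by auto
    then have "norm q * norm p \<le> H p"
      using b[of p] by (simp add: pos_le_divide_eq)
    then show ?thesis using norm_cauchy_schwarz[of p q] by (simp add: mult.commute)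
  qed
  then show ?thesis by (auto simp: bdd_above_def)
qed

lemma legendre_ge: "p \<bullet> q - H p \<le> legendre H q"
  unfolding legendre_def by (rule cSUP_upper[OF _ bdd_above_legendre]) simp

lemma legendre_attained: "\<exists>q. legendre H q = p \<bullet> q - H p"
proof -
  obtain q where "\<And>p'. H p' \<ge> H p + (p' - p) \<bullet> q"
    using subgradient by blast
  then have "legendre H q \<le> p \<bullet> q - H p"
    unfolding legendre_def by (intro cSUP_least) (auto simp: inner_diff_left algebra_simps)
  then show ?thesis
    using legendre_ge[of p q] by (intro exI[of _ q]) simp
qed

lemma legendre_superlinear: "\<exists>M. \<forall>q. legendre H q \<ge> R * norm q - M"
proof -
  obtain M where M: "\<And>p. p \<in> cball 0 \<bar>R\<bar> \<Longrightarrow> \<bar>H p\<bar> \<le> M"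
    using bounded_on_cball by blast
  have "legendre H q \<ge> R * norm q - M" for q
  proof -
    define p where "p = (R / norm q) *\<^sub>R q"
    have "p \<bullet> q = R * norm q"
      by (cases "q = 0") (simp_all add: p_def dot_square_norm power2_eq_square)
    moreover have "\<bar>H p\<bar> \<le> M"
      by (rule M) (simp add: p_def)
    ultimately show ?thesis
      using legendre_ge[of p q] by simp
  qed
  then show ?thesis by blast
qed

lemma legendre_convex:
  assumes "s > 0" "t > 0"
  shows "(t + s) * legendre H ((v + w) /\<^sub>R (t + s))
    \<le> t * legendre H (v /\<^sub>R t) + s * legendre H (w /\<^sub>R s)" (is "_ \<le> ?B")
proof -
  have "p \<bullet> ((v + w) /\<^sub>R (t + s)) - H p \<le> ?B / (t + s)" for p
  proof -
    have "p \<bullet> ((v + w) /\<^sub>R (t + s)) = (p \<bullet> v + p \<bullet> w) / (t + s)"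
      by (simp add: inner_add_right divide_inverse)
    then have "(p \<bullet> ((v + w) /\<^sub>R (t + s)) - H p) * (t + s) = p \<bullet> v + p \<bullet> w - t * H p - s * H p"
      using assms by (simp add: left_diff_distrib) (simp add: algebra_simps)
    also have "\<dots> = t * (p \<bullet> (v /\<^sub>R t) - H p) + s * (p \<bullet> (w /\<^sub>R s) - H p)"
      using assms by (simp add: right_diff_distrib mult.assoc[symmetric])
    also have "\<dots> \<le> ?B"
      using assms by (intro add_mono mult_left_mono legendre_ge) auto
    finally show ?thesis using assms by (simp add: pos_le_divide_eq)
  qed
  then have "legendre H ((v + w) /\<^sub>R (t + s)) \<le> ?B / (t + s)"
    unfolding legendre_def[of H "(v + w) /\<^sub>R (t + s)"] by (intro cSUP_least) auto
  then show ?thesis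
    using assms by (simp add: pos_le_divide_eq mult.commute)
qed

end

text \<open>A convex Hamiltonian together with a Lipschitz initial datum.\<close>

locale hopf_lax_datum = convex_hamiltonian H for H :: "'a::euclidean_space \<Rightarrow> real" +
  fixes u0 :: "'a \<Rightarrow> real" and C :: real
  assumes lipschitz: "C-lipschitz_on UNIV u0"
begin

abbreviation u where "u \<equiv> hopf_lax H u0"

lemma u0_lipschitz: "\<bar>u0 x - u0 y\<bar> \<le> C * norm (x - y)"
  using lipschitz_onD[OF lipschitz, of x y] by (simp add: dist_norm)

lemma bdd_below_hopf_lax:
  assumes "t > 0"
  shows "bdd_below (range (\<lambda>y. u0 y + t * legendre H ((x - y) /\<^sub>R t)))"
proof -
  obtain M where M: "\<And>q. legendre H q \<ge> C * norm q - M"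
    using legendre_superlinear by blast
  have "u0 x - t * M \<le> u0 y + t * legendre H ((x - y) /\<^sub>R t)" for y
  proof -
    have "C * norm (x - y) - t * M = t * (C * norm ((x - y) /\<^sub>R t) - M)"
      using assms by (simp add: right_diff_distrib mult.assoc[symmetric])
    also have "\<dots> \<le> t * legendre H ((x - y) /\<^sub>R t)"
      using assms by (intro mult_left_mono M) auto
    finally show ?thesis using u0_lipschitz[of x y] by linarith
  qed
  then show ?thesis by (auto simp: bdd_below_def)
qed

lemma hopf_lax_le: "t > 0 \<Longrightarrow> u t x \<le> u0 y + t * legendre H ((x - y) /\<^sub>R t)"
  by (auto simp: hopf_lax_def intro!: cINF_lower bdd_below_hopf_lax)

lemma hopf_lax_approx:
  assumes "t > 0" "e > 0"
  obtains y where "u0 y + t * legendre H ((x - y) /\<^sub>R t) < u t x + e"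
proof -
  have "\<exists>y\<in>UNIV. u0 y + t * legendre H ((x - y) /\<^sub>R t) < u t x + e"
    using assms bdd_below_hopf_lax[of t x]
    by (subst cINF_less_iff[symmetric]) (auto simp: hopf_lax_def)
  then show ?thesis using that by blast
qed

text \<open>The two halves of the dynamic programming principle
  \<open>u(t + s, x) = inf y. u(t, y) + s L((x - y) / s)\<close>: the first is convexity of \<open>L\<close>, the second
  splits a straight line at time \<open>t\<close>.\<close>

lemma semigroup_le:
  assumes "t \<ge> 0" "s > 0"
  shows "u (t + s) x \<le> u t y + s * legendre H ((x - y) /\<^sub>R s)"
proof (cases "t = 0")
  case True
  then show ?thesis
    using hopf_lax_le[OF assms(2), of x y] by (simp add: hopf_lax_def[of H u0 0])
next
  case False
  then have t: "t > 0" using assms by simp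
  show ?thesis
  proof (rule field_le_epsilon)
    fix e :: real assume "e > 0"
    obtain z where z: "u0 z + t * legendre H ((y - z) /\<^sub>R t) < u t y + e"
      by (rule hopf_lax_approx[OF t \<open>e > 0\<close>])
    have "u (t + s) x \<le> u0 z + (t + s) * legendre H ((x - z) /\<^sub>R (t + s))"
      using t assms by (intro hopf_lax_le) auto
    also have "(t + s) * legendre H ((x - z) /\<^sub>R (t + s))
        \<le> t * legendre H ((y - z) /\<^sub>R t) + s * legendre H ((x - y) /\<^sub>R s)"
      using legendre_convex[OF assms(2) t, of "y - z" "x - y"] by simp
    finally show "u (t + s) x \<le> u t y + s * legendre H ((x - y) /\<^sub>R s) + e"
      using z by simp
  qed
qed

lemma semigroup_approx:
  assumes "t \<ge> 0" "s > 0" "e > 0"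
  obtains y where "u t y + s * legendre H ((x - y) /\<^sub>R s) < u (t + s) x + e"
proof (cases "t = 0")
  case True
  with hopf_lax_approx[OF assms(2,3), of x] that show ?thesis
    by (auto simp: hopf_lax_def[of H u0 0])
next
  case False
  then have t: "t > 0" using assms by simp
  then obtain z where z: "u0 z + (t + s) * legendre H ((x - z) /\<^sub>R (t + s)) < u (t + s) x + e"
    using hopf_lax_approx[of "t + s" e x] assms by auto
  \<comment> \<open>the point at time \<open>t\<close> of the straight line from \<open>(0, z)\<close> to \<open>(t + s, x)\<close>\<close>
  define y where "y = z + (t / (t + s)) *\<^sub>R (x - z)"
  have "y - z = (t / (t + s)) *\<^sub>R (x - z)" by (simp add: y_def)
  then have 1: "(y - z) /\<^sub>R t = (x - z) /\<^sub>R (t + s)"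
    using t by (simp add: divide_inverse)
  have "x - y = (1 - t / (t + s)) *\<^sub>R (x - z)"
    by (simp add: y_def algebra_simps)
  also have "1 - t / (t + s) = s / (t + s)"
    using t assms by (simp add: field_simps)
  finally have 2: "(x - y) /\<^sub>R s = (x - z) /\<^sub>R (t + s)"
    using assms by (simp add: divide_inverse)
  have "u t y \<le> u0 z + t * legendre H ((y - z) /\<^sub>R t)"
    using t by (rule hopf_lax_le)
  then have "u t y + s * legendre H ((x - y) /\<^sub>R s)
      \<le> u0 z + (t + s) * legendre H ((x - z) /\<^sub>R (t + s))"
    by (simp add: 1 2 distrib_right)
  then show ?thesis
    using z by (rule that[OF le_less_trans])
qed

lemma hopf_lax_lipschitz_space:
  assumes "t \<ge> 0"
  shows "\<bar>u t x - u t y\<bar> \<le> C * norm (x - y)"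
proof (cases "t = 0")
  case True
  then show ?thesis using u0_lipschitz by (simp add: hopf_lax_def)
next
  case False
  then have t: "t > 0" using assms by simp
  have "u t x \<le> u t y + C * norm (x - y)" for x y
  proof (rule field_le_epsilon)
    fix e :: real assume "e > 0"
    obtain z where z: "u0 z + t * legendre H ((y - z) /\<^sub>R t) < u t y + e"
      by (rule hopf_lax_approx[OF t \<open>e > 0\<close>])
    have "u t x \<le> u0 (z + (x - y)) + t * legendre H ((x - (z + (x - y))) /\<^sub>R t)"
      using t by (rule hopf_lax_le)
    also have "x - (z + (x - y)) = y - z" by simp
    finally show "u t x \<le> u t y + C * norm (x - y) + e"
      using z u0_lipschitz[of "z + (x - y)" z] by simp
  qed
  from this[of x y] this[of y x] show ?thesis by (simp add: norm_minus_commute abs_le_iff)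
qed

lemma hopf_lax_lipschitz_time:
  "\<exists>M\<ge>0. \<forall>s\<ge>0. \<forall>t\<ge>0. \<forall>x. \<bar>u (t + s) x - u t x\<bar> \<le> M * s"
proof -
  obtain M where M: "\<And>q. legendre H q \<ge> C * norm q - M"
    using legendre_superlinear by blast
  define B where "B = max \<bar>M\<bar> \<bar>legendre H 0\<bar>"
  have B: "M \<le> B" "legendre H 0 \<le> B" "0 \<le> B" by (auto simp: B_def)
  have "\<bar>u (t + s) x - u t x\<bar> \<le> B * s"
    if "t \<ge> 0" "s \<ge> 0" for s t x
  proof (cases "s = 0")
    case False
    with that have s: "s > 0" by simp
    have "u (t + s) x \<le> u t x + s * legendre H 0"
      using semigroup_le[OF that(1) s, of x x] by simp
    moreover have "s * legendre H 0 \<le> s * B"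
      using s B(2) by simp
    moreover have "u t x \<le> u (t + s) x + s * M"
    proof (rule field_le_epsilon)
      fix e :: real assume "e > 0"
      obtain y where y: "u t y + s * legendre H ((x - y) /\<^sub>R s) < u (t + s) x + e"
        by (rule semigroup_approx[OF \<open>t \<ge> 0\<close> s \<open>e > 0\<close>])
      have "C * norm (x - y) - s * M = s * (C * norm ((x - y) /\<^sub>R s) - M)"
        using s by (simp add: right_diff_distrib)
      also have "\<dots> \<le> s * legendre H ((x - y) /\<^sub>R s)"
        using s by (intro mult_left_mono M) auto
      finally show "u t x \<le> u (t + s) x + s * M + e"
        using y hopf_lax_lipschitz_space[OF that(1), of x y] by linarith
    qed
    moreover have "s * M \<le> s * B"
      using s B(1) by simp
    ultimately show ?thesis unfolding mult.commute[of B] by linarith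
  qed simp
  with B(3) show ?thesis by blast
qed

lemma continuous_hopf_lax: "continuous_on ({0..} \<times> UNIV) (\<lambda>(t, x). u t x)"
proof -
  obtain M where M: "M \<ge> 0" "\<And>s t x. t \<ge> 0 \<Longrightarrow> s \<ge> 0 \<Longrightarrow> \<bar>u (t + s) x - u t x\<bar> \<le> M * s"
    using hopf_lax_lipschitz_time by blast
  have C: "C \<ge> 0" using lipschitz by (rule lipschitz_on_nonneg)
  have time: "\<bar>u s x - u t x\<bar> \<le> M * \<bar>s - t\<bar>" if "s \<ge> 0" "t \<ge> 0" for s t x
    using M(2)[of t "s - t" x] M(2)[of s "t - s" x] that by (cases "s \<le> t") auto
  have "(M + C)-lipschitz_on ({0..} \<times> UNIV) (\<lambda>(t, x). u t x)"
  proof (rule lipschitz_onI; clarsimp?)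
    fix s t :: real and x y :: 'a
    assume "0 \<le> s" "0 \<le> t"
    then have "\<bar>u s x - u t y\<bar> \<le> M * \<bar>s - t\<bar> + C * norm (x - y)"
      using time[of s t x] hopf_lax_lipschitz_space[of t x y] by simp
    also have "\<dots> \<le> M * dist (s, x) (t, y) + C * dist (s, x) (t, y)"
      using M(1) C dist_fst_le[of "(s, x)" "(t, y)"] dist_snd_le[of "(s, x)" "(t, y)"]
      by (intro add_mono mult_left_mono) (auto simp: dist_norm)
    finally show "dist (u s x) (u t y) \<le> (M + C) * dist (s, x) (t, y)"
      by (simp add: dist_real_def algebra_simps)
  qed (use M(1) C in simp)
  then show ?thesis by (rule lipschitz_on_continuous_on)
qed

text \<open>Only differentiability of the test function at the touching point is used below.\<close>

lemma test_function_derivative: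
  fixes \<phi> :: "real \<Rightarrow> 'a \<Rightarrow> real"
  assumes "t > 0" "Ck_on 1 (\<lambda>(s, y). \<phi> s y) ({0<..} \<times> UNIV)"
  shows "((\<lambda>z. \<phi> (fst z) (snd z)) has_derivative
    (\<lambda>z. deriv (\<lambda>s. \<phi> s x) t * fst z + grad (\<phi> t) x \<bullet> snd z)) (at (t, x))"
proof -
  have "(\<lambda>(s, y). \<phi> s y) differentiable (at (t, x))"
    using assms by auto
  moreover have "(\<lambda>(s, y). \<phi> s y) = (\<lambda>z. \<phi> (fst z) (snd z))" by auto
  ultimately obtain F where F: "((\<lambda>z. \<phi> (fst z) (snd z)) has_derivative F) (at (t, x))"
    unfolding differentiable_def by metis
  then have linF: "linear F" by (rule has_derivative_linear)
  have "((\<lambda>s. (s, x)) has_derivative (\<lambda>h. (h, 0))) (at t)"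
    by (auto intro!: derivative_eq_intros)
  from has_derivative_compose[OF this F]
  have "((\<lambda>s. \<phi> s x) has_derivative (\<lambda>h. F (h, 0))) (at t)" by simp
  moreover have time: "(\<lambda>h. F (h, 0)) = (*) (F (1, 0))"
  proof
    show "F (h, 0) = F (1, 0) * h" for h
      using linear_scale[OF linF, of h "(1, 0)"] by (simp add: mult.commute)
  qed
  ultimately have "((\<lambda>s. \<phi> s x) has_real_derivative F (1, 0)) (at t)"
    by (simp only: has_field_derivative_def)
  then have a: "deriv (\<lambda>s. \<phi> s x) t = F (1, 0)" by (rule DERIV_imp_deriv)
  have "((\<lambda>y. (t, y)) has_derivative (\<lambda>h. (0, h))) (at x)"
    by (auto intro!: derivative_eq_intros)
  from has_derivative_compose[OF this F]
  have D: "(\<phi> t has_derivative (\<lambda>h. F (0, h))) (at x)" by simp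
  define p where "p = adjoint (\<lambda>h. F (0, h)) 1"
  have space: "F (0, h) = h \<bullet> p" for h
    using adjoint_works[OF has_derivative_linear[OF D], of h 1] by (simp add: p_def)
  with D have p: "grad (\<phi> t) x = p" by (intro grad_eqI) (simp add: gderiv_def)
  have "F = (\<lambda>z. F (1, 0) * fst z + p \<bullet> snd z)"
  proof
    fix z
    have "F z = F (fst z, 0) + F (0, snd z)"
      using linear_add[OF linF, of "(fst z, 0)" "(0, snd z)"] by simp
    then show "F z = F (1, 0) * fst z + p \<bullet> snd z"
      using fun_cong[OF time, of "fst z"] space[of "snd z"]
      by (simp add: inner_commute)
  qed
  with F show ?thesis by (simp only: a p)
qed

text \<open>Follow a straight line of velocity \<open>q\<close> backwards from the touching point, where \<open>q\<close> is
  optimal for the spatial gradient \<open>p\<close> of the test function.\<close>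

lemma hopf_lax_subsolution: "viscosity_subsolution H u"
  unfolding viscosity_subsolution_def
proof (intro allI impI)
  fix \<phi> :: "real \<Rightarrow> 'a \<Rightarrow> real" and t :: real and x :: 'a
  assume t: "t > 0" and \<phi>: "Ck_on 1 (\<lambda>(s, y). \<phi> s y) ({0<..} \<times> UNIV)"
    and max: "\<forall>\<^sub>F (s, y) in nhds (t, x). u s y - \<phi> s y \<le> u t x - \<phi> t x"
  define a where "a = deriv (\<lambda>s. \<phi> s x) t"
  define p where "p = grad (\<phi> t) x"
  obtain q where q: "legendre H q = p \<bullet> q - H p" using legendre_attained by blast
  note D = test_function_derivative[OF t \<phi>, of x, folded a_def p_def]
  let ?z = "\<lambda>s. (t - s, x - s *\<^sub>R q)"
  have "(?z has_derivative (\<lambda>s. (- s, - s *\<^sub>R q))) (at 0)"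
    by (auto intro!: derivative_eq_intros)
  from has_derivative_compose[OF this, of "\<lambda>z. \<phi> (fst z) (snd z)"
      "\<lambda>z. a * fst z + p \<bullet> snd z"] D
  have "((\<lambda>s. \<phi> (t - s) (x - s *\<^sub>R q)) has_derivative (\<lambda>s. - (a + p \<bullet> q) * s)) (at 0)"
    by (simp add: algebra_simps)
  then have "((\<lambda>s. \<phi> (t - s) (x - s *\<^sub>R q)) has_real_derivative - (a + p \<bullet> q)) (at 0)"
    by (simp add: has_field_derivative_def)
  then have lim: "((\<lambda>s. (\<phi> (t - s) (x - s *\<^sub>R q) - \<phi> t x) / s) \<longlongrightarrow> - (a + p \<bullet> q)) (at_right 0)"
    by (auto simp: has_field_derivative_iff intro: filterlim_at_split[THEN iffD1, THEN conjunct2])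
  have "(?z \<longlongrightarrow> ?z 0) (at_right 0)"
    by (intro tendsto_intros)
  then have "\<forall>\<^sub>F s in at_right 0. u (t - s) (x - s *\<^sub>R q) - \<phi> (t - s) (x - s *\<^sub>R q) \<le> u t x - \<phi> t x"
    using eventually_compose_filterlim[OF max, of ?z] by simp
  moreover have "\<forall>\<^sub>F s in at_right 0. 0 < s \<and> s < t"
    using t by (auto simp: eventually_at_right_field)
  ultimately have "\<forall>\<^sub>F s in at_right 0. (\<phi> (t - s) (x - s *\<^sub>R q) - \<phi> t x) / s \<ge> - legendre H q"
  proof eventually_elim
    case (elim s)
    have "u t x \<le> u (t - s) (x - s *\<^sub>R q) + s * legendre H q"
      using semigroup_le[of "t - s" s x "x - s *\<^sub>R q"] elim by simp
    with elim show ?case by (simp add: field_simps)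
  qed
  then have "- (a + p \<bullet> q) \<ge> - legendre H q"
    by (intro tendsto_lowerbound[OF lim]) auto
  then show "deriv (\<lambda>s. \<phi> s x) t + H (grad (\<phi> t) x) \<le> 0"
    using q by (simp add: a_def p_def)
qed

text \<open>Almost optimal straight lines of duration \<open>s\<close> have velocity bounded independently of \<open>s\<close>,
  because \<open>u\<close> is Lipschitz and \<open>L\<close> superlinear. Hence the test function may be linearised along
  them with an error \<open>o(s)\<close>.\<close>

lemma hopf_lax_supersolution: "viscosity_supersolution H u"
  unfolding viscosity_supersolution_def
proof (intro allI impI)
  fix \<phi> :: "real \<Rightarrow> 'a \<Rightarrow> real" and t :: real and x :: 'a
  assume t: "t > 0" and \<phi>: "Ck_on 1 (\<lambda>(s, y). \<phi> s y) ({0<..} \<times> UNIV)"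
    and min: "\<forall>\<^sub>F (s, y) in nhds (t, x). u s y - \<phi> s y \<ge> u t x - \<phi> t x"
  define a where "a = deriv (\<lambda>s. \<phi> s x) t"
  define p where "p = grad (\<phi> t) x"
  note D = test_function_derivative[OF t \<phi>, of x, folded a_def p_def]
  obtain M where M: "\<And>q. legendre H q \<ge> (C + 1) * norm q - M"
    using legendre_superlinear[of "C + 1"] by blast
  \<comment> \<open>a bound for the speed of all almost optimal straight lines ending at \<open>(t, x)\<close>\<close>
  define R where "R = \<bar>M\<bar> + \<bar>legendre H 0\<bar> + 1"
  have R: "R > 0" by (simp add: R_def)
  obtain d1 where d1: "d1 > 0"
    "\<And>s y. dist (s, y) (t, x) < d1 \<Longrightarrow> u s y - \<phi> s y \<ge> u t x - \<phi> t x"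
    using min unfolding eventually_nhds_metric by fast
  have "- (a + H p) \<le> 0"
  proof (rule field_le_epsilon)
    fix e' :: real assume "e' > 0"
    define e where "e = e' / (2 + R)"
    have e: "e > 0" "e' = e * (2 + R)" using \<open>e' > 0\<close> R by (auto simp: e_def)
    obtain d2 where d2: "d2 > 0"
      "\<And>s y. norm ((s, y) - (t, x)) < d2 \<Longrightarrow>
        \<bar>\<phi> s y - \<phi> t x - (a * (s - t) + p \<bullet> (y - x))\<bar> \<le> e * norm ((s, y) - (t, x))"
    proof -
      obtain d where "d > 0" and d: "\<And>z. norm (z - (t, x)) < d \<Longrightarrow>
          norm (\<phi> (fst z) (snd z) - \<phi> (fst (t, x)) (snd (t, x)) - (a * fst (z - (t, x)) + p \<bullet> snd (z - (t, x))))
            \<le> e * norm (z - (t, x))"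
        using D e(1) unfolding has_derivative_at_alt by blast
      from d[of "(s, y)" for s y] \<open>d > 0\<close> show ?thesis
        by (intro that[of d]) auto
    qed
    define s where "s = Min {t, 1, e, d1 / (2 + R), d2 / (2 + R)} / 2"
    have s: "s > 0" "s < t" "s \<le> 1" "s \<le> e" "s * (1 + R) < d1" "s * (1 + R) < d2"
    proof -
      have m: "0 < 2 * s" "2 * s \<le> t" "2 * s \<le> 1" "2 * s \<le> e"
        "2 * s \<le> d1 / (2 + R)" "2 * s \<le> d2 / (2 + R)"
        using t e d1 d2 R by (auto simp: s_def)
      then show "s > 0" "s < t" "s \<le> 1" "s \<le> e" by linarith+
      have "s * (1 + R) < 2 * s * (2 + R)"
        using \<open>s > 0\<close> mult_pos_pos[OF \<open>s > 0\<close> R] by (simp add: algebra_simps)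
      moreover have "2 * s * (2 + R) \<le> d1" "2 * s * (2 + R) \<le> d2"
        using m(5,6) R by (auto simp: pos_le_divide_eq)
      ultimately show "s * (1 + R) < d1" "s * (1 + R) < d2" by linarith+
    qed
    obtain y where y: "u (t - s) y + s * legendre H ((x - y) /\<^sub>R s) < u t x + s * s"
      using semigroup_approx[of "t - s" s "s * s" x] s by auto
    define q where "q = (x - y) /\<^sub>R s"
    have xy: "x - y = s *\<^sub>R q" using s by (simp add: q_def)
    then have nxy: "norm (x - y) = s * norm q" using s by simp
    have "u t x \<le> u (t - s) x + s * legendre H 0"
      using semigroup_le[of "t - s" s x x] s by simp
    moreover have "u (t - s) x - u (t - s) y \<le> C * (s * norm q)"
      using hopf_lax_lipschitz_space[of "t - s" x y] s by (simp add: nxy)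
    ultimately have "s * legendre H q \<le> s * (C * norm q + legendre H 0 + s)"
      using y by (simp add: q_def algebra_simps)
    then have "legendre H q \<le> C * norm q + legendre H 0 + s" using s by simp
    then have q: "norm q \<le> R"
      using M[of q] s by (simp add: R_def algebra_simps)
    have "norm ((t - s, y) - (t, x)) \<le> norm (- s) + norm (y - x)"
      using norm_Pair_le[of "- s" "y - x"] by simp
    also have "\<dots> \<le> s * (1 + R)"
      using s q nxy by (simp add: norm_minus_commute algebra_simps)
    finally have near: "norm ((t - s, y) - (t, x)) \<le> s * (1 + R)" .
    have "u (t - s) y - \<phi> (t - s) y \<ge> u t x - \<phi> t x"
      using d1(2)[of "t - s" y] near s by (simp add: dist_norm)
    moreover have "\<bar>\<phi> (t - s) y - \<phi> t x - (a * ((t - s) - t) + p \<bullet> (y - x))\<bar>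
        \<le> e * (s * (1 + R))"
      using d2(2)[of "t - s" y] near s e by (smt (verit) mult_left_mono)
    moreover have "p \<bullet> (y - x) = - (s * (p \<bullet> q))"
      using xy by (metis inner_minus_right inner_scaleR_right minus_diff_eq)
    ultimately have "s * legendre H q - s * s \<le> s * a + s * (p \<bullet> q) + s * (e * (1 + R))"
      using y[folded q_def] by (simp add: algebra_simps)
    then have "s * legendre H q \<le> s * (a + p \<bullet> q + e * (1 + R) + s)"
      by (simp add: algebra_simps)
    then have "legendre H q \<le> a + p \<bullet> q + e * (1 + R) + s"
      using s by simp
    with legendre_ge[of p q] s(4) show "- (a + H p) \<le> 0 + e'"
      by (simp add: e(2) algebra_simps)
  qed
  then show "deriv (\<lambda>s. \<phi> s x) t + H (grad (\<phi> t) x) \<ge> 0"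
    by (simp add: a_def p_def)
qed

theorem hopf_lax_viscosity_solution: "viscosity_solution H u0 u"
  unfolding viscosity_solution_def
proof (intro conjI)
  show "u 0 = u0" by (simp add: hopf_lax_def fun_eq_iff)
qed (fact continuous_hopf_lax hopf_lax_subsolution hopf_lax_supersolution)+

end

section \<open>The Hamiltonian\<close>

text \<open>The Hamiltonian of the counterexample; \<open>27/256\<close> is the constant for which the Legendre
  transform in the first variable is the power \<open>4/3\<close> of the modulus without a factor.\<close>

definition hamiltonian :: "real^2 \<Rightarrow> real" where
  "hamiltonian p = 27 / 256 * (p $ 1)^4 + (p $ 2)^2"

lemma inner_plane: "(x :: real^2) \<bullet> y = x $ 1 * y $ 1 + x $ 2 * y $ 2"
  by (simp add: inner_vec_def sum_2)

lemma norm_plane_power2: "(norm (x :: real^2))\<^sup>2 = (x $ 1)\<^sup>2 + (x $ 2)\<^sup>2"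
  unfolding power2_norm_eq_inner inner_plane by (simp add: power2_eq_square)

lemma smooth_hamiltonian: "smooth hamiltonian"
proof (rule smooth_algebra_smooth)
  have coord: "(\<lambda>p::real^2. p $ i) \<in> smooth_algebra" for i
    by (intro smooth_algebra.linear bounded_linear_vec_nth)
  have eq: "hamiltonian = (\<lambda>p. 27 / 256 * (p $ 1 * p $ 1 * (p $ 1 * p $ 1)) + p $ 2 * p $ 2)"
    by (simp add: hamiltonian_def fun_eq_iff power4_eq_xxxx power2_eq_square mult.assoc)
  show "hamiltonian \<in> smooth_algebra"
    unfolding eq by (intro smooth_algebra.add smooth_algebra.mult smooth_algebra.const coord)
qed

lemma grad_hamiltonian: "grad hamiltonian p = vector [27 / 64 * (p $ 1)^3, 2 * p $ 2]"
proof (rule grad_eqI)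
  show "GDERIV hamiltonian p :> vector [27 / 64 * (p $ 1)^3, 2 * p $ 2]"
    unfolding gderiv_def hamiltonian_def
    by (auto intro!: derivative_eq_intros
        bounded_linear_imp_has_derivative[OF bounded_linear_vec_nth] simp: inner_plane)
qed

lemma strictly_convex_power2:
  fixes a b t :: real
  assumes "a \<noteq> b" "0 < t" "t < 1"
  shows "((1 - t) * a + t * b)\<^sup>2 < (1 - t) * a\<^sup>2 + t * b\<^sup>2"
proof -
  have "(1 - t) * a\<^sup>2 + t * b\<^sup>2 - ((1 - t) * a + t * b)\<^sup>2 = t * (1 - t) * (a - b)\<^sup>2"
    by (simp add: power2_eq_square algebra_simps)
  also have "\<dots> > 0" using assms by simp
  finally show ?thesis by simp
qed

lemma strictly_convex_power4:
  fixes a b t :: real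
  assumes "a \<noteq> b" "0 < t" "t < 1"
  shows "((1 - t) * a + t * b)^4 < (1 - t) * a^4 + t * b^4"
proof -
  have sq: "x^4 = (x\<^sup>2)\<^sup>2" for x :: real by simp
  have "(((1 - t) * a + t * b)\<^sup>2)\<^sup>2 < ((1 - t) * a\<^sup>2 + t * b\<^sup>2)\<^sup>2"
    using strictly_convex_power2[OF assms] by (intro power_strict_mono) auto
  also have "\<dots> \<le> (1 - t) * (a\<^sup>2)\<^sup>2 + t * (b\<^sup>2)\<^sup>2"
    using strictly_convex_power2[of "a\<^sup>2" "b\<^sup>2" t] assms
    by (cases "a\<^sup>2 = b\<^sup>2") (auto simp: algebra_simps)
  finally show ?thesis by (simp only: sq)
qed

lemma strictly_convex_hamiltonian: "strictly_convex hamiltonian"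
  unfolding strictly_convex_def
proof (intro allI impI)
  fix x y :: "real^2" and t :: real
  assume xy: "x \<noteq> y" and t: "0 < t" "t < 1"
  define f where "f a b = (1 - t) * a^4 + t * b^4 - ((1 - t) * a + t * b)^4" for a b
  define g where "g a b = (1 - t) * a\<^sup>2 + t * b\<^sup>2 - ((1 - t) * a + t * b)\<^sup>2" for a b
  have pos: "f a b > 0" "g a b > 0" if "a \<noteq> b" for a b
    using strictly_convex_power4[OF that t] strictly_convex_power2[OF that t]
    by (simp_all add: f_def g_def)
  have "f a a = 0" "g a a = 0" for a by (simp_all add: f_def g_def algebra_simps)
  with pos have nonneg: "f a b \<ge> 0" "g a b \<ge> 0" for a b
    by (metis less_eq_real_def)+
  have "x $ 1 \<noteq> y $ 1 \<or> x $ 2 \<noteq> y $ 2" using xy by (auto simp: vec_eq_iff forall_2)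
  then have "0 < 27 / 256 * f (x $ 1) (y $ 1) + g (x $ 2) (y $ 2)"
    using pos nonneg by (smt (verit) mult_pos_pos mult_nonneg_nonneg divide_pos_pos)
  then show "hamiltonian ((1 - t) *\<^sub>R x + t *\<^sub>R y) < (1 - t) * hamiltonian x + t * hamiltonian y"
    by (simp add: hamiltonian_def f_def g_def algebra_simps diff_divide_distrib)
qed

lemma coercive_hamiltonian: "coercive hamiltonian"
  unfolding coercive_def
proof (rule filterlim_at_top_mono)
  show "filterlim (\<lambda>p::real^2. - 1 + 27 / 128 * norm p) at_top at_infinity"
    by (intro filterlim_tendsto_add_at_top[OF tendsto_const]
        filterlim_tendsto_pos_mult_at_top[OF tendsto_const] filterlim_norm_at_top) simp
next
  have "- 1 + 27 / 128 * norm p \<le> hamiltonian p / norm p" if "norm p \<ge> 1" for p :: "real^2"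
  proof -
    have "((p $ 1)\<^sup>2 - 1)\<^sup>2 \<ge> 0" by simp
    then have "(p $ 1)^4 \<ge> 2 * (p $ 1)\<^sup>2 - 1"
      by (simp add: power2_eq_square power4_eq_xxxx algebra_simps)
    then have "27 / 256 * (2 * (p $ 1)\<^sup>2 - 1) + 27 / 128 * (p $ 2)\<^sup>2 \<le> hamiltonian p"
      unfolding hamiltonian_def by (intro add_mono mult_left_mono mult_left_le_one_le) auto
    then have "hamiltonian p \<ge> 27 / 128 * (norm p)\<^sup>2 - 27 / 256"
      by (simp add: norm_plane_power2 algebra_simps diff_divide_distrib)
    then have "(- 1 + 27 / 128 * norm p) * norm p \<le> hamiltonian p"
      using that by (simp add: algebra_simps power2_eq_square)
    then show ?thesis using that by (subst pos_le_divide_eq) auto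
  qed
  then show "\<forall>\<^sub>F p in at_infinity. - 1 + 27 / 128 * norm (p :: real^2) \<le> hamiltonian p / norm p"
    by (auto simp: eventually_at_infinity)
qed

lemma not_uniformly_directionally_convex_hamiltonian: "\<not> uniformly_directionally_convex hamiltonian"
proof
  define I where "I = (\<lambda>(p, q). ((grad hamiltonian p - grad hamiltonian q) /\<^sub>R
      norm (grad hamiltonian p - grad hamiltonian q)) \<bullet> ((p - q) /\<^sub>R norm (p - q)))"
  define S :: "((real^2) \<times> (real^2)) set"
    where "S = {(p, q). p \<in> cball 0 1 \<and> q \<in> cball 0 1 \<and> p \<noteq> q}"
  assume "uniformly_directionally_convex hamiltonian"
  then have pos: "(INF z\<in>S. I z) > 0"
    unfolding uniformly_directionally_convex_def I_def S_def
    by (elim allE[of _ 1]) simp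
  have "I z \<ge> - 1" for z
  proof -
    obtain p q where z: "z = (p, q)" by fastforce
    let ?v = "(grad hamiltonian p - grad hamiltonian q) /\<^sub>R norm (grad hamiltonian p - grad hamiltonian q)"
    let ?w = "(p - q) /\<^sub>R norm (p - q)"
    have "\<bar>?v \<bullet> ?w\<bar> \<le> norm ?v * norm ?w" by (rule Cauchy_Schwarz_ineq2)
    also have "\<dots> \<le> 1 * 1"
    proof (rule mult_mono)
      have "norm (x /\<^sub>R norm x) \<le> 1" for x :: "real^2" by (cases "x = 0") auto
      then show "norm ?v \<le> 1" "norm ?w \<le> 1" by blast+
    qed auto
    finally show ?thesis by (simp add: I_def z)
  qed
  then have bdd: "bdd_below (I ` S)" by (rule bdd_belowI2)
  \<comment> \<open>near the origin the increments of \<open>DH\<close> along \<open>(s, s\<^sup>2)\<close> become orthogonal to it\<close>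
  have small: "(INF z\<in>S. I z) \<le> 3 * s" if s: "0 < s" "s < 1 / 2" for s
  proof -
    define p :: "real^2" where "p = vector [s, s\<^sup>2]"
    have p: "p $ 1 = s" "p $ 2 = s\<^sup>2" by (simp_all add: p_def)
    define g where "g = grad hamiltonian p"
    have g: "g $ 1 = 27 / 64 * s^3" "g $ 2 = 2 * s\<^sup>2"
      by (simp_all add: g_def grad_hamiltonian p)
    have "norm p \<le> \<bar>p $ 1\<bar> + \<bar>p $ 2\<bar>" using norm_le_l1_cart[of p] by (simp add: sum_2)
    also have "\<dots> \<le> 1 / 2 + (1 / 2)\<^sup>2"
      using s power_mono[of s "1 / 2" 2] by (intro add_mono) (auto simp: p)
    finally have "norm p \<le> 1" by (simp add: power2_eq_square)
    moreover have "p \<noteq> 0" using p s by auto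
    ultimately have "(INF z\<in>S. I z) \<le> I (p, 0)"
      by (intro cINF_lower bdd) (auto simp: S_def)
    also have "grad hamiltonian 0 = 0"
      by (simp add: grad_hamiltonian vec_eq_iff forall_2)
    then have "I (p, 0) = (g \<bullet> p) / (norm g * norm p)"
      by (simp add: I_def g_def divide_inverse)
    also have "\<dots> \<le> 3 * s"
    proof -
      have "norm g \<ge> 2 * s\<^sup>2" using component_le_norm_cart[of g 2] s by (simp add: g)
      moreover have "norm p \<ge> s" using component_le_norm_cart[of p 1] s by (simp add: p)
      ultimately have *: "norm g * norm p \<ge> 2 * s\<^sup>2 * s"
        using s by (intro mult_mono) auto
      have "g \<bullet> p = (27 / 64 + 2) * s^4"
        by (simp add: inner_plane g p power2_eq_square power3_eq_cube power4_eq_xxxx)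
      also have "\<dots> \<le> 6 * s^4" using s by simp
      also have "\<dots> = 3 * s * (2 * s\<^sup>2 * s)"
        by (simp add: power2_eq_square power4_eq_xxxx)
      also have "\<dots> \<le> 3 * s * (norm g * norm p)"
        using * s by (intro mult_left_mono) auto
      finally show ?thesis
        using * s by (subst pos_divide_le_eq) (auto intro: less_le_trans[rotated])
    qed
    finally show ?thesis .
  qed
  have "(INF z\<in>S. I z) \<le> (INF z\<in>S. I z) / 2"
  proof (cases "(INF z\<in>S. I z) < 1")
    case True
    then show ?thesis using small[of "(INF z\<in>S. I z) / 6"] pos by simp
  next
    case False
    then show ?thesis using small[of "1 / 6"] by simp
  qed
  with pos show False by simp
qed

lemma power4_above_tangent: "(a::real)^4 \<ge> b^4 + 4 * b^3 * (a - b)"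
proof -
  have "a^4 - b^4 - 4 * b^3 * (a - b) = (a - b)\<^sup>2 * ((a + b)\<^sup>2 + 2 * b\<^sup>2)"
    by (simp add: power2_eq_square power3_eq_cube power4_eq_xxxx algebra_simps)
  also have "\<dots> \<ge> 0" by simp
  finally show ?thesis by simp
qed

lemma hamiltonian_above_tangent:
  "hamiltonian p' \<ge> hamiltonian p + (p' - p) \<bullet> grad hamiltonian p"
proof -
  have "(p' $ 2 - p $ 2)\<^sup>2 \<ge> 0" by simp
  then have "(p' $ 2)\<^sup>2 \<ge> (p $ 2)\<^sup>2 + (p' $ 2 - p $ 2) * (2 * p $ 2)"
    by (simp add: power2_eq_square algebra_simps)
  moreover have "27 / 256 * (p' $ 1)^4 \<ge> 27 / 256 * ((p $ 1)^4 + 4 * (p $ 1)^3 * (p' $ 1 - p $ 1))"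
    by (intro mult_left_mono power4_above_tangent) auto
  ultimately show ?thesis
    by (simp add: hamiltonian_def grad_hamiltonian inner_plane power3_eq_cube power4_eq_xxxx
        algebra_simps diff_divide_distrib)
qed

interpretation hamiltonian: convex_hamiltonian hamiltonian
proof
  show "continuous_on UNIV hamiltonian"
    unfolding hamiltonian_def by (intro continuous_intros)
qed (use coercive_hamiltonian hamiltonian_above_tangent in blast)+

text \<open>Here \<open>root 3\<close> is the odd cube root, so that its fourth power is the modulus to the power
  \<open>4/3\<close> on the whole line.\<close>

lemma legendre_hamiltonian: "legendre hamiltonian q = (root 3 (q $ 1))^4 + (q $ 2)\<^sup>2 / 4"
proof -
  define s where "s = root 3 (q $ 1)"
  have q1: "q $ 1 = s^3" by (simp add: s_def odd_real_root_pow)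
  define p0 :: "real^2" where "p0 = vector [4 / 3 * s, q $ 2 / 2]"
  have val: "p0 \<bullet> q - hamiltonian p0 = s^4 + (q $ 2)\<^sup>2 / 4"
    by (simp add: p0_def inner_plane hamiltonian_def q1 power2_eq_square power3_eq_cube
        power4_eq_xxxx field_simps)
  have "grad hamiltonian p0 = q"
    by (simp add: grad_hamiltonian vec_eq_iff forall_2 p0_def q1 power_mult_distrib power_divide)
  then have "p \<bullet> q - hamiltonian p \<le> p0 \<bullet> q - hamiltonian p0" for p
    using hamiltonian_above_tangent[of p0 p] by (simp add: inner_diff_left)
  then have "legendre hamiltonian q = p0 \<bullet> q - hamiltonian p0"
    unfolding legendre_def by (intro cSup_eq_maximum) auto
  with val show ?thesis by (simp add: s_def)
qed

section \<open>The solution at time one\<close>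

text \<open>The dyadic interval from \<open>2\<close> to the power \<open>-n\<close> to its double is divided into subintervals
  of length \<open>2\<close> to the power \<open>-kn\<close>; \<open>node k n i\<close> is the left end of the \<open>i\<close>-th one. The set
  \<open>comb k\<close> is the complement of the open subintervals of all scales \<open>n\<close>: the ends of the
  subintervals, together with \<open>x \<le> 0\<close> and \<open>x \<ge> 2\<close>.\<close>

definition node :: "nat \<Rightarrow> nat \<Rightarrow> nat \<Rightarrow> real" where
  "node k n i = 1 / 2 ^ n + real i / 2 ^ (k * n)"

definition comb :: "nat \<Rightarrow> real set" where
  "comb k = - (\<Union>n. \<Union>i<2 ^ ((k - 1) * n). {node k n i<..<node k n (Suc i)})"

lemma node_Suc: "node k n (Suc i) = node k n i + 1 / 2 ^ (k * n)"
  by (simp add: node_def add_divide_distrib)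

lemma node_mono: "i \<le> j \<Longrightarrow> node k n i \<le> node k n j"
  by (simp add: node_def divide_right_mono)

lemma node_bounds:
  assumes "k \<ge> 1" "i \<le> 2 ^ ((k - 1) * n)"
  shows "1 / 2 ^ n \<le> node k n i" "node k n i \<le> 2 / 2 ^ n"
proof -
  have "real i \<le> 2 ^ ((k - 1) * n)"
    using assms(2) by (metis of_nat_le_iff of_nat_numeral of_nat_power)
  moreover have "k * n = (k - 1) * n + n"
    using assms(1) by (simp add: algebra_simps flip: add_mult_distrib)
  ultimately have "real i / 2 ^ (k * n) \<le> 1 / 2 ^ n"
    by (simp add: power_add field_simps)
  then show "1 / 2 ^ n \<le> node k n i" "node k n i \<le> 2 / 2 ^ n"
    by (simp_all add: node_def)
qed

lemma node_in_comb:
  assumes k: "k \<ge> 1" and i: "i < 2 ^ ((k - 1) * n)"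
  shows "node k n i \<in> comb k"
proof -
  have False if j: "j < 2 ^ ((k - 1) * m)"
    and in_gap: "node k m j < node k n i" "node k n i < node k m (Suc j)" for m j
  proof (cases m n rule: linorder_cases)
    case equal
    then show False
      using in_gap node_mono[of i j k n] node_mono[of "Suc j" i k n] by force
  next
    case less
    have "node k n i < 2 / 2 ^ n"
      using node_mono[of "Suc i" "2 ^ ((k - 1) * n)" k n] i node_bounds[OF k order_refl, of n]
        node_Suc[of k n i] by (smt (verit) Suc_leI zero_less_divide_1_iff zero_less_power)
    also have "\<dots> \<le> 1 / 2 ^ m"
      using power_increasing[of "Suc m" n "2::real"] less by (simp add: field_simps)
    also have "\<dots> \<le> node k m j"
      using node_bounds[OF k, of j m] j by simp
    finally show False using in_gap by simp
  next
    case greater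
    have "node k m (Suc j) \<le> 2 / 2 ^ m"
      using node_bounds[OF k, of "Suc j" m] j by simp
    also have "\<dots> \<le> 1 / 2 ^ n"
      using power_increasing[of "Suc n" m "2::real"] greater by (simp add: field_simps)
    also have "\<dots> \<le> node k n i"
      using node_bounds[OF k, of i n] i by simp
    finally show False using in_gap by simp
  qed
  then show ?thesis by (auto simp: comb_def)
qed

lemma closed_comb: "closed (comb k)"
  unfolding comb_def by (intro closed_Compl open_UN) auto

lemma infdist_comb:
  assumes k: "k \<ge> 1" and i: "i < 2 ^ ((k - 1) * n)"
    and x: "node k n i \<le> x" "x \<le> node k n i + 1 / 2 ^ (k * n) / 2"
  shows "infdist x (comb k) = x - node k n i"
proof (rule antisym)
  show "infdist x (comb k) \<le> x - node k n i"
    using infdist_le[OF node_in_comb[OF k i], of x] x by (simp add: dist_real_def)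
  have "x - node k n i \<le> dist x a" if "a \<in> comb k" for a
  proof -
    have "a \<notin> {node k n i<..<node k n (Suc i)}"
      using that i by (auto simp: comb_def)
    then show ?thesis
      using x by (auto simp: node_Suc dist_real_def)
  qed
  then show "x - node k n i \<le> infdist x (comb k)"
    using node_in_comb[OF k i] by (subst infdist_notempty) (auto intro!: cINF_greatest)
qed

lemma infdist_comb_le_1:
  assumes k: "k \<ge> 1"
  shows "infdist x (comb k) \<le> 1"
proof (cases "x \<in> comb k")
  case False
  then obtain n i where i: "i < 2 ^ ((k - 1) * n)" and x: "node k n i < x" "x < node k n (Suc i)"
    by (auto simp: comb_def)
  have "(1::real) / 2 ^ (k * n) \<le> 1" by simp
  then have "dist x (node k n i) \<le> 1"
    using x unfolding node_Suc dist_real_def by linarith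
  then show ?thesis
    by (rule infdist_le2[OF node_in_comb[OF k i]])
qed simp

lemma comb_nonempty: "k \<ge> 1 \<Longrightarrow> comb k \<noteq> {}"
  using node_in_comb[of k 0 0] by auto

text \<open>A Lipschitz datum vanishing exactly on the lines \<open>y\<^sub>1 \<in> A\<close> and \<open>y\<^sub>2 \<in> B\<close> (for closed
  nonempty \<open>A\<close>, \<open>B\<close>). If no point has distance above \<open>1\<close> from \<open>A\<close> or from \<open>B\<close>, the
  slopes are large enough for the points of these lines to be the only
  relevant ones in the Hopf--Lax formula at time \<open>1\<close>.\<close>

definition grid_datum :: "real set \<Rightarrow> real set \<Rightarrow> real^2 \<Rightarrow> real" where
  "grid_datum A B y = min (2 * infdist (y $ 1) A) (infdist (y $ 2) B)"

lemma lipschitz_grid_datum: "2-lipschitz_on UNIV (grid_datum A B)"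
proof (rule lipschitz_onI)
  fix x y :: "real^2"
  have "\<bar>infdist (x $ i) Z - infdist (y $ i) Z\<bar> \<le> dist x y" for i Z
    using infdist_triangle_abs[of "x $ i" Z "y $ i"] dist_vec_nth_le[of x i y] by linarith
  from this[of 1 A] this[of 2 B] show "dist (grid_datum A B x) (grid_datum A B y) \<le> 2 * dist x y"
    unfolding grid_datum_def dist_real_def by linarith
qed simp

lemma power4_diff_le_power3_diff:
  fixes a b :: real
  assumes "0 \<le> b" "b \<le> a" "a \<le> 1"
  shows "a^4 - b^4 \<le> 2 * (a^3 - b^3)"
proof -
  define q where "q = a\<^sup>2 + a * b + b\<^sup>2"
  have "b\<^sup>2 \<le> q" "0 \<le> q" using assms by (simp_all add: q_def)
  then have "a * q \<le> 1 * q" "b * b\<^sup>2 \<le> 1 * b\<^sup>2"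
    using assms by (intro mult_right_mono; simp)+
  with \<open>b\<^sup>2 \<le> q\<close> have "a * q + b * b\<^sup>2 \<le> 2 * q" by simp
  then have "(a - b) * (a * q + b * b\<^sup>2) \<le> (a - b) * (2 * q)"
    using assms by (intro mult_left_mono) auto
  then show ?thesis
    by (simp add: q_def power2_eq_square power3_eq_cube power4_eq_xxxx algebra_simps)
qed

lemma infdist_le_infdist_add: "infdist x A \<le> infdist y A + \<bar>x - y\<bar>"
  using infdist_triangle[of x A y] by (simp add: dist_real_def)

lemma root3_power4_abs: "(root 3 \<bar>x\<bar>)^4 = (root 3 x)^4"
  by (simp add: real_root_abs)

lemma root3_power4_infdist_le:
  assumes "infdist x A \<le> 1"
  shows "(root 3 (infdist x A))^4 \<le> 2 * infdist y A + (root 3 (x - y))^4"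
proof (cases "infdist x A \<le> \<bar>x - y\<bar>")
  case True
  then have "(root 3 (infdist x A))^4 \<le> (root 3 \<bar>x - y\<bar>)^4"
    by (intro power_mono) (auto simp: infdist_nonneg)
  then show ?thesis
    using infdist_nonneg[of y A] by (simp add: root3_power4_abs)
next
  case False
  define a b where "a = root 3 (infdist x A)" and "b = root 3 \<bar>x - y\<bar>"
  have "0 \<le> b" "b \<le> a" "a \<le> 1" using False assms by (auto simp: a_def b_def)
  then have "a^4 - b^4 \<le> 2 * (a^3 - b^3)" by (rule power4_diff_le_power3_diff)
  also have "a^3 - b^3 = infdist x A - \<bar>x - y\<bar>"
    by (simp add: a_def b_def infdist_nonneg)
  also have "\<dots> \<le> infdist y A"
    using infdist_le_infdist_add[of x A y] by simp
  finally show ?thesis by (simp add: a_def b_def root3_power4_abs)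
qed

lemma power2_infdist_le:
  assumes "infdist x A \<le> 1"
  shows "(infdist x A)\<^sup>2 / 4 \<le> infdist y A + (x - y)\<^sup>2 / 4"
proof (cases "infdist x A \<le> \<bar>x - y\<bar>")
  case True
  then have "(infdist x A)\<^sup>2 \<le> \<bar>x - y\<bar>\<^sup>2"
    by (intro power_mono) (auto simp: infdist_nonneg)
  then show ?thesis using infdist_nonneg[of y A] by simp
next
  case False
  have "(infdist x A)\<^sup>2 - (x - y)\<^sup>2 = (infdist x A - \<bar>x - y\<bar>) * (infdist x A + \<bar>x - y\<bar>)"
    by (simp add: power2_eq_square algebra_simps)
  also have "\<dots> \<le> infdist y A * 2"
    using False assms infdist_le_infdist_add[of x A y]
    by (intro mult_mono) (auto simp: infdist_nonneg)
  finally show ?thesis using infdist_nonneg[of y A] by simp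
qed

text \<open>Inf-convolution commutes with minima, so the two families of lines contribute
  independently, each through the distance of one coordinate to a closed set.\<close>

lemma hopf_lax_grid_datum:
  assumes A: "closed A" "A \<noteq> {}" "\<And>x. infdist x A \<le> 1"
    and B: "closed B" "B \<noteq> {}" "\<And>x. infdist x B \<le> 1"
  shows "hopf_lax hamiltonian (grid_datum A B) 1 x
    = min ((root 3 (infdist (x $ 1) A))^4) ((infdist (x $ 2) B)\<^sup>2 / 4)" (is "_ = min ?F ?G")
proof -
  define K where "K y = grid_datum A B y + ((root 3 (x $ 1 - y $ 1))^4 + (x $ 2 - y $ 2)\<^sup>2 / 4)" for y
  have hl: "hopf_lax hamiltonian (grid_datum A B) 1 x = (INF y. K y)"
    by (simp add: hopf_lax_def legendre_hamiltonian K_def)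
  have "K y \<ge> 0" for y
    by (auto simp: K_def grid_datum_def infdist_nonneg)
  then have bdd: "bdd_below (range K)" by (rule bdd_belowI2)
  obtain a where a: "a \<in> A" "infdist (x $ 1) A = dist (x $ 1) a"
    using infdist_attains_inf[OF A(1,2)] by blast
  obtain b where b: "b \<in> B" "infdist (x $ 2) B = dist (x $ 2) b"
    using infdist_attains_inf[OF B(1,2)] by blast
  have "K (vector [a, x $ 2]) = ?F"
    using a by (simp add: K_def grid_datum_def dist_real_def root3_power4_abs infdist_nonneg)
  moreover have "K (vector [x $ 1, b]) = ?G"
    using b by (simp add: K_def grid_datum_def dist_real_def infdist_nonneg)
  ultimately have "(INF y. K y) \<le> min ?F ?G"
    using cINF_lower[OF bdd UNIV_I, of "vector [a, x $ 2]"]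
      cINF_lower[OF bdd UNIV_I, of "vector [x $ 1, b]"] by simp
  moreover have "min ?F ?G \<le> (INF y. K y)"
  proof (rule cINF_greatest)
    fix y :: "real^2"
    have "(root 3 (x $ 1 - y $ 1))^4 \<ge> 0" "(x $ 2 - y $ 2)\<^sup>2 \<ge> 0" by simp_all
    with root3_power4_infdist_le[OF A(3), of "x $ 1" "y $ 1"]
      power2_infdist_le[OF B(3), of "x $ 2" "y $ 2"]
    show "min ?F ?G \<le> K y"
      unfolding K_def grid_datum_def by linarith
  qed simp
  ultimately show ?thesis unfolding hl by (rule antisym)
qed

text \<open>The solution at time \<open>1\<close>. The exponents \<open>9\<close> and \<open>6\<close> give mesh sizes that match as
  \<open>e\<^sup>3\<close> and \<open>e\<^sup>2\<close>, the scaling under which both profiles have the size \<open>e\<close> to the fourth.\<close>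

definition u1 :: "real^2 \<Rightarrow> real" where
  "u1 = hopf_lax hamiltonian (grid_datum (comb 9) (comb 6)) 1"

text \<open>The lower left quarters of the grid rectangles of scale \<open>n\<close>: there the nearest grid lines
  are the left and the lower side.\<close>

definition cell :: "nat \<Rightarrow> nat \<Rightarrow> nat \<Rightarrow> (real^2) set" where
  "cell n i j = box (vector [node 9 n i, node 6 n j])
    (vector [node 9 n i + 1 / 2 ^ (9 * n) / 2, node 6 n j + 1 / 2 ^ (6 * n) / 2])"

lemma mem_cell: "x \<in> cell n i j \<longleftrightarrow>
    node 9 n i < x $ 1 \<and> x $ 1 < node 9 n i + 1 / 2 ^ (9 * n) / 2 \<and>
    node 6 n j < x $ 2 \<and> x $ 2 < node 6 n j + 1 / 2 ^ (6 * n) / 2"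
  by (auto simp: cell_def mem_box_cart forall_2)

lemma u1_cell:
  assumes "i < 2 ^ (8 * n)" "j < 2 ^ (5 * n)" "x \<in> cell n i j"
  shows "u1 x = min ((root 3 (x $ 1 - node 9 n i))^4) ((x $ 2 - node 6 n j)\<^sup>2 / 4)"
  using assms
  by (simp add: u1_def hopf_lax_grid_datum closed_comb comb_nonempty infdist_comb_le_1
      infdist_comb mem_cell)

text \<open>In a cell with lower left corner \<open>z\<close> and coordinates \<open>s = x\<^sub>1 - z\<^sub>1\<close>,
  \<open>t = x\<^sub>2 - z\<^sub>2\<close>, the two profiles \<open>s\<close> to the power \<open>4/3\<close> and \<open>t\<^sup>2 / 4\<close> agree
  exactly on the graph \<open>s = (t / 2)\<close> to the power \<open>3/2\<close>.\<close>

definition interface :: "real \<Rightarrow> real" where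
  "interface t = (sqrt (t / 2))^3"

lemma root3_power4_less_iff:
  assumes "0 < s" "0 < t"
  shows "t\<^sup>2 / 4 < (root 3 s)^4 \<longleftrightarrow> interface t < s"
    and "(root 3 s)^4 < t\<^sup>2 / 4 \<longleftrightarrow> s < interface t"
proof -
  define r q where "r = root 3 s" and "q = sqrt (t / 2)"
  have rq: "0 < r" "0 < q" "r^3 = s" "q^4 = t\<^sup>2 / 4"
  proof -
    have "q^4 = (q\<^sup>2)\<^sup>2" by simp
    also have "\<dots> = t\<^sup>2 / 4" using assms by (simp add: q_def power_divide)
    finally show "q^4 = t\<^sup>2 / 4" .
  qed (use assms in \<open>auto simp: r_def q_def\<close>)
  then show "t\<^sup>2 / 4 < (root 3 s)^4 \<longleftrightarrow> interface t < s"
    and "(root 3 s)^4 < t\<^sup>2 / 4 \<longleftrightarrow> s < interface t"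
    unfolding interface_def r_def[symmetric] q_def[symmetric] rq(3,4)[symmetric]
    using rq(1,2) by (simp_all flip: not_le add: real_root_power_cancel)
qed

lemma grad_u1_cell:
  assumes ij: "i < 2 ^ (8 * n)" "j < 2 ^ (5 * n)" and x: "x \<in> cell n i j"
  shows "x $ 1 - node 9 n i > interface (x $ 2 - node 6 n j) \<Longrightarrow>
      grad u1 x $ 2 = (x $ 2 - node 6 n j) / 2"
    and "x $ 1 - node 9 n i < interface (x $ 2 - node 6 n j) \<Longrightarrow> grad u1 x $ 2 = 0"
proof -
  define F G :: "real^2 \<Rightarrow> real"
    where "F x = (root 3 (x $ 1 - node 9 n i))^4" and "G x = (x $ 2 - node 6 n j)\<^sup>2 / 4" for x
  have u1: "u1 y = min (F y) (G y)" if "y \<in> cell n i j" for y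
    using u1_cell[OF ij that] by (simp add: F_def G_def)
  have cont: "continuous_on UNIV F" "continuous_on UNIV G"
    unfolding F_def G_def by (intro continuous_intros; simp)+
  have opens: "open (cell n i j \<inter> {y. G y < F y})" "open (cell n i j \<inter> {y. F y < G y})"
    by (intro open_Int open_Collect_less cont; simp add: cell_def open_box)+
  note coord = bounded_linear_imp_has_derivative[OF bounded_linear_vec_nth]
  have pos: "x $ 1 - node 9 n i > 0" "x $ 2 - node 6 n j > 0"
    using x by (simp_all add: mem_cell)
  {
    assume "x $ 1 - node 9 n i > interface (x $ 2 - node 6 n j)"
    then have "G x < F x"
      using root3_power4_less_iff(1)[OF pos] by (simp add: F_def G_def)
    moreover have "GDERIV G x :> vector [0, (x $ 2 - node 6 n j) / 2]"
      unfolding gderiv_def G_def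
      by (auto intro!: derivative_eq_intros coord simp: inner_plane)
    ultimately have "GDERIV u1 x :> vector [0, (x $ 2 - node 6 n j) / 2]"
      unfolding gderiv_def using x u1
      by (elim has_derivative_transform_within_open[OF _ opens(1)]) (auto simp: min_def)
    then show "grad u1 x $ 2 = (x $ 2 - node 6 n j) / 2"
      by (simp add: grad_eqI)
  next
    assume "x $ 1 - node 9 n i < interface (x $ 2 - node 6 n j)"
    then have "F x < G x"
      using root3_power4_less_iff(2)[OF pos] by (simp add: F_def G_def)
    moreover obtain d where "GDERIV F x :> vector [d, 0]"
    proof -
      define d where "d = 4 * (inverse (3 * (root 3 (x $ 1 - node 9 n i))\<^sup>2) * (root 3 (x $ 1 - node 9 n i))^3)"
      have "((\<lambda>s. (root 3 s)^4) has_real_derivative d) (at (x $ 1 - node 9 n i))"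
        unfolding d_def using pos DERIV_power[OF DERIV_real_root[of 3 "x $ 1 - node 9 n i"], of 4]
        by (simp add: numeral_eq_Suc)
      then have d: "((\<lambda>s. (root 3 s)^4) has_derivative (\<lambda>h. h * d)) (at (x $ 1 - node 9 n i))"
        unfolding has_field_derivative_def by (simp only: mult_commute_abs)
      have "((\<lambda>y. y $ 1 - node 9 n i) has_derivative (\<lambda>h. h $ 1)) (at x)"
        by (auto intro!: derivative_eq_intros coord)
      from has_derivative_compose[OF this d] have "GDERIV F x :> vector [d, 0]"
        by (simp add: gderiv_def F_def[abs_def] inner_plane)
      then show ?thesis by (rule that)
    qed
    ultimately have "GDERIV u1 x :> vector [d, 0]"
      unfolding gderiv_def using x u1
      by (elim has_derivative_transform_within_open[OF _ opens(2)]) (auto simp: min_def)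
    then show "grad u1 x $ 2 = 0"
      by (simp add: grad_eqI)
  }
qed

section \<open>Bump functions on rectangles\<close>

text \<open>A smooth function on the line that is positive on \<open>(0, 1/2)\<close> and zero elsewhere, and its
  derivative.\<close>

definition bump :: "real \<Rightarrow> real" where
  "bump t = flat 1 t * flat 1 (1 / 2 - t)"

definition bump' :: "real \<Rightarrow> real" where
  "bump' t = flat [:0, 0, 1:] t * flat 1 (1 / 2 - t) - flat 1 t * flat [:0, 0, 1:] (1 / 2 - t)"

lemma has_derivative_bump: "(bump has_real_derivative bump' t) (at t)"
proof -
  have "(flat 1 has_real_derivative flat [:0, 0, 1:] t) (at t)" for t
    using has_derivative_flat[of 1 t] by simp
  note flat = this
  have "((\<lambda>t. flat 1 (1 / 2 - t)) has_real_derivative flat [:0, 0, 1:] (1 / 2 - t) * - 1) (at t)"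
    by (rule DERIV_chain2[OF flat]) (auto intro!: derivative_eq_intros)
  from DERIV_mult[OF flat this] show ?thesis
    by (simp add: bump_def[abs_def] bump'_def mult.commute)
qed

lemma flat_1_bounds: "0 \<le> flat 1 t" "flat 1 t \<le> 1"
  by (simp_all add: flat_def)

lemma bump_bounds: "0 \<le> bump t" "bump t \<le> 1"
  using flat_1_bounds[of t] flat_1_bounds[of "1 / 2 - t"]
  by (simp_all add: bump_def mult_le_one)

lemma bump_eq_0: "t \<notin> {0<..<1/2} \<Longrightarrow> bump t = 0" "t \<notin> {0<..<1/2} \<Longrightarrow> bump' t = 0"
  by (auto simp: bump_def bump'_def flat_def)

lemma bump_pos: "t \<in> {0<..<1/2} \<Longrightarrow> bump t > 0"
  by (auto simp: bump_def flat_def)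

lemma continuous_bump: "continuous_on A bump"
  by (rule DERIV_continuous_on) (rule has_field_derivative_at_within[OF has_derivative_bump])

lemma continuous_bump': "continuous_on A bump'"
proof -
  have "continuous_on UNIV (flat p)" for p
    by (rule DERIV_continuous_on) (rule has_field_derivative_at_within[OF has_derivative_flat])
  then have flat: "continuous_on A (\<lambda>t. flat p (f t))" if "continuous_on A f" for p f
    using continuous_on_compose2[of UNIV "flat p" A f] that by simp
  show ?thesis
    unfolding bump'_def by (intro continuous_intros flat)
qed

lemma bump'_bounded: "\<exists>M. \<forall>t. \<bar>bump' t\<bar> \<le> M"
proof -
  have "compact (bump' ` {0..1/2})"
    by (intro compact_continuous_image continuous_bump') auto
  then have "bounded (bump' ` {0..1/2})" by (rule compact_imp_bounded)
  then obtain M where M: "\<And>t. t \<in> {0..1/2} \<Longrightarrow> \<bar>bump' t\<bar> \<le> M"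
    unfolding bounded_iff by force
  have "\<bar>bump' t\<bar> \<le> max M 0" for t
    using M[of t] bump_eq_0(2)[of t] by (cases "t \<in> {0<..<1/2}") auto
  then show ?thesis by blast
qed

lemma borel_measurable_bump [measurable]: "bump \<in> borel_measurable borel"
  "bump' \<in> borel_measurable borel"
  by (intro borel_measurable_continuous_onI continuous_bump continuous_bump')+

text \<open>The product bump function on the open \<open>a/2\<close> by \<open>h/2\<close> rectangle with lower left corner
  \<open>z\<close>.\<close>

definition cell_bump :: "real^2 \<Rightarrow> real \<Rightarrow> real \<Rightarrow> real^2 \<Rightarrow> real" where
  "cell_bump z a h x = bump ((x $ 1 - z $ 1) / a) * bump ((x $ 2 - z $ 2) / h)"

lemma smooth_cell_bump: "smooth (cell_bump z a h)"
proof (rule smooth_algebra_smooth)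
  have coord: "(\<lambda>x::real^2. x $ i) \<in> smooth_algebra" for i
    by (intro smooth_algebra.linear bounded_linear_vec_nth)
  have aff: "(\<lambda>x::real^2. b * x $ i + c) \<in> smooth_algebra" for b c i
    by (intro smooth_algebra.intros coord)
  have "(\<lambda>x::real^2. bump (b * x $ i + c)) \<in> smooth_algebra" for b c i
  proof -
    have "(\<lambda>x::real^2. bump (b * x $ i + c))
        = (\<lambda>x. flat 1 (b * x $ i + c) * flat 1 ((- b) * x $ i + (1 / 2 - c)))"
      by (simp add: bump_def algebra_simps)
    also have "\<dots> \<in> smooth_algebra"
      by (intro smooth_algebra.mult smooth_algebra.flat aff)
    finally show ?thesis .
  qed
  from smooth_algebra.mult[OF this[of "1 / a" 1 "- z $ 1 / a"] this[of "1 / h" 2 "- z $ 2 / h"]]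
  show "cell_bump z a h \<in> smooth_algebra"
    by (simp add: cell_bump_def[abs_def] diff_divide_distrib)
qed

lemma cell_bump_bounds: "0 \<le> cell_bump z a h x" "cell_bump z a h x \<le> 1"
  using bump_bounds by (simp_all add: cell_bump_def mult_le_one)

lemma cell_bump_eq_0:
  assumes "a > 0" "h > 0" "x \<notin> box z (vector [z $ 1 + a / 2, z $ 2 + h / 2])"
  shows "cell_bump z a h x = 0"
proof -
  have "(x $ 1 - z $ 1) / a \<notin> {0<..<1/2} \<or> (x $ 2 - z $ 2) / h \<notin> {0<..<1/2}"
    using assms by (auto simp: mem_box_cart forall_2 field_simps)
  then show ?thesis by (auto simp: cell_bump_def bump_eq_0)
qed

lemma test_function_cell_bump:
  assumes "a > 0" "h > 0"
  shows "test_function (cell_bump z a h)"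
proof -
  have "{x. cell_bump z a h x \<noteq> 0} \<subseteq> box z (vector [z $ 1 + a / 2, z $ 2 + h / 2])"
    using cell_bump_eq_0[OF assms] by blast
  then have "bounded {x. cell_bump z a h x \<noteq> 0}"
    using bounded_box bounded_subset by blast
  then show ?thesis
    by (simp add: test_function_def smooth_cell_bump)
qed

lemma frechet_derivative_cell_bump:
  assumes "a > 0"
  shows "frechet_derivative (cell_bump z a h) (at x) (axis 1 1)
    = bump' ((x $ 1 - z $ 1) / a) / a * bump ((x $ 2 - z $ 2) / h)"
proof -
  note coord = bounded_linear_imp_has_derivative[OF bounded_linear_vec_nth]
  have D: "((\<lambda>x. bump ((x $ i - c) / b)) has_derivative (\<lambda>v. v $ i / b * bump' ((x $ i - c) / b))) (at x)"
    for i c b and x :: "real^2"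
  proof -
    have "((\<lambda>x. (x $ i - c) / b) has_derivative (\<lambda>v. v $ i / b)) (at x)"
      unfolding divide_inverse by (auto intro!: derivative_eq_intros coord)
    from has_derivative_compose[OF this has_derivative_bump[unfolded has_field_derivative_def]]
    show ?thesis by (simp add: mult.commute)
  qed
  have "(cell_bump z a h has_derivative
      (\<lambda>v. bump ((x $ 1 - z $ 1) / a) * (v $ 2 / h * bump' ((x $ 2 - z $ 2) / h))
        + v $ 1 / a * bump' ((x $ 1 - z $ 1) / a) * bump ((x $ 2 - z $ 2) / h))) (at x)"
    unfolding cell_bump_def[abs_def] by (rule has_derivative_mult[OF D D])
  from frechet_derivative_at[OF this, symmetric] show ?thesis
    by (simp add: axis_def)
qed

section \<open>Integration over the plane\<close>

lemma measurable_plane: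
  "(\<lambda>(a, b). vector [a, b] :: real^2) \<in> measurable (lborel \<Otimes>\<^sub>M lborel) borel"
proof -
  have "vector [a, b] = a *\<^sub>R axis 1 1 + b *\<^sub>R (axis 2 1 :: real^2)" for a b
    by (simp add: vec_eq_iff forall_2 axis_def)
  then show ?thesis by (simp add: split_beta)
qed

lemma lborel_plane: "lborel = distr (lborel \<Otimes>\<^sub>M lborel) borel (\<lambda>(a, b). vector [a, b] :: real^2)"
proof (rule lborel_eqI)
  fix l u :: "real^2"
  assume le: "\<And>b. b \<in> Basis \<Longrightarrow> l \<bullet> b \<le> u \<bullet> b"
  have le': "l $ 1 \<le> u $ 1" "l $ 2 \<le> u $ 2" using le[of "axis 1 1"] le[of "axis 2 1"] by (auto simp: inner_axis)
  have "(\<lambda>(a, b). vector [a, b] :: real^2) -` box l u \<inter> space (lborel \<Otimes>\<^sub>M lborel)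
     = {l $ 1<..<u $ 1} \<times> {l $ 2<..<u $ 2}"
    by (auto simp: mem_box_cart forall_2 space_pair_measure)
  then have "emeasure (distr (lborel \<Otimes>\<^sub>M lborel) borel (\<lambda>(a, b). vector [a, b] :: real^2)) (box l u)
    = ennreal (u $ 1 - l $ 1) * ennreal (u $ 2 - l $ 2)"
    using le' by (simp add: emeasure_distr[OF measurable_plane] lborel.emeasure_pair_measure_Times)
  also have "\<dots> = (\<Prod>b\<in>Basis. (u - l) \<bullet> b)"
  proof -
    have "(Basis :: (real^2) set) = {axis 1 1, axis 2 1}"
      by (auto simp: Basis_vec_def UNIV_2)
    then have "(\<Prod>b\<in>Basis. (u - l) \<bullet> b) = (\<Prod>b\<in>{axis 1 1, axis 2 1}. (u - l) \<bullet> b)"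
      by (rule arg_cong)
    also have "\<dots> = (u $ 1 - l $ 1) * (u $ 2 - l $ 2)"
      by (simp add: axis_eq_axis inner_axis)
    finally have "(\<Prod>b\<in>Basis. (u - l) \<bullet> b) = (u $ 1 - l $ 1) * (u $ 2 - l $ 2)" .
    with le' show ?thesis by (simp add: ennreal_mult)
  qed
  finally show "emeasure (distr (lborel \<Otimes>\<^sub>M lborel) borel (\<lambda>(a, b). vector [a, b] :: real^2)) (box l u)
    = (\<Prod>b\<in>Basis. (u - l) \<bullet> b)" .
qed simp

lemma AE_not_on_graph:
  fixes k :: "real \<Rightarrow> real"
  assumes [measurable]: "k \<in> borel_measurable borel"
  shows "AE x in lebesgue. (x :: real^2) $ 1 \<noteq> k (x $ 2)"
proof -
  have [measurable]: "(\<lambda>x::real^2. x $ i) \<in> borel_measurable borel" for i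
    by (intro borel_measurable_continuous_onI continuous_intros)
  have "AE t in lborel. AE s in lborel. s \<noteq> k t"
    by (intro AE_I2 AE_lborel_singleton)
  then have "AE s in lborel. AE t in lborel. s \<noteq> k t"
    by (subst lborel_pair.AE_commute) measurable
  moreover have "{z \<in> space (lborel \<Otimes>\<^sub>M lborel). fst z \<noteq> k (snd z)} \<in> sets (lborel \<Otimes>\<^sub>M lborel)"
    by measurable
  ultimately have "AE z in lborel \<Otimes>\<^sub>M lborel. fst z \<noteq> k (snd z)"
    by (intro lborel_pair.AE_pair_measure) simp_all
  then have "AE x in lborel. (x :: real^2) $ 1 \<noteq> k (x $ 2)"
    unfolding lborel_plane by (subst AE_distr_iff[OF measurable_plane]) (auto simp: case_prod_unfold)
  then show ?thesis by (rule AE_completion)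
qed

lemma integral_lebesgue_plane:
  fixes f :: "real \<Rightarrow> real \<Rightarrow> real"
  assumes [measurable]: "(\<lambda>(s, t). f s t) \<in> borel_measurable (lborel \<Otimes>\<^sub>M lborel)"
    and int: "integrable (lborel \<Otimes>\<^sub>M lborel) (\<lambda>(s, t). f s t)"
  shows "(LINT x|lebesgue. f ((x::real^2) $ 1) (x $ 2)) = (LINT t|lborel. LINT s|lborel. f s t)"
proof -
  have meas: "(\<lambda>x::real^2. f (x $ 1) (x $ 2)) \<in> borel_measurable borel"
  proof -
    have "(\<lambda>x::real^2. (x $ 1, x $ 2)) \<in> measurable borel (lborel \<Otimes>\<^sub>M lborel)"
      by (intro measurable_Pair) (auto intro!: borel_measurable_continuous_onI continuous_intros)
    from measurable_compose[OF this assms(1)] show ?thesis by simp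
  qed
  have "(LINT x|lebesgue. f ((x::real^2) $ 1) (x $ 2)) = (LINT x|lborel. f ((x::real^2) $ 1) (x $ 2))"
    using meas by (intro integral_completion) simp
  also have "\<dots> = (LINT z|(lborel \<Otimes>\<^sub>M lborel). (case z of (s, t) \<Rightarrow> f s t))"
    unfolding lborel_plane using meas
    by (subst integral_distr[OF measurable_plane]) (simp_all add: case_prod_unfold)
  also have "\<dots> = (LINT t|lborel. LINT s|lborel. f s t)"
    using lborel_pair.integral_snd[OF int] by simp
  finally show ?thesis .
qed

section \<open>The mixed derivative in one cell\<close>

lemma interface_nonneg: "t \<ge> 0 \<Longrightarrow> interface t \<ge> 0"
  by (simp add: interface_def)

lemma interface_scale: "e \<ge> 0 \<Longrightarrow> interface (e\<^sup>2 * t) = e^3 * interface t"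
  by (simp add: interface_def real_sqrt_mult power_mult_distrib flip: times_divide_eq_right)

lemma continuous_interface: "continuous_on A interface"
  unfolding interface_def by (intro continuous_intros) auto

lemma borel_measurable_interface [measurable]: "interface \<in> borel_measurable borel"
  by (intro borel_measurable_continuous_onI continuous_interface)

lemma interface_less:
  assumes "0 < t" "t < 1 / 2"
  shows "interface t \<in> {0<..<1/2}"
proof -
  have "sqrt (t / 2) < sqrt ((1 / 2)\<^sup>2)"
    using assms by (intro real_sqrt_less_mono) (simp add: power2_eq_square field_simps)
  then have "sqrt (t / 2) < 1 / 2" by (simp only: real_sqrt_abs)
  then have "(sqrt (t / 2))^3 < (1 / 2)^3"
    using assms by (intro power_strict_mono) auto
  then show ?thesis using assms by (simp add: interface_def power3_eq_cube)
qed

text \<open>Up to sign, the pairing of \<open>t\<close> times the indicator of \<open>s > interface t\<close> with the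
  \<open>s\<close>-derivative of the bump function of the unit cell, after integration in \<open>s\<close>.\<close>

definition cell_variation :: real where
  "cell_variation = (LINT t|lborel. t * bump t * bump (interface t))"

lemma integrable_cell_variation: "integrable lborel (\<lambda>t. t * bump t * bump (interface t))"
proof (rule Bochner_Integration.integrable_bound)
  show "integrable lborel (indicator {0..1} :: real \<Rightarrow> real)"
    by (intro integrable_real_indicator) auto
  have "\<bar>t * bump t * bump (interface t)\<bar> \<le> indicator {0..1} t" for t
  proof (cases "t \<in> {0<..<1/2}")
    case True
    then have "\<bar>t\<bar> * bump t * bump (interface t) \<le> 1"
      using bump_bounds[of t] bump_bounds[of "interface t"]
      by (intro mult_le_one) (auto simp: zero_le_mult_iff)
    with True show ?thesis
      using bump_bounds[of t] bump_bounds[of "interface t"] by (simp add: abs_mult)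
  qed (simp add: bump_eq_0)
  then show "AE t in lborel. norm (t * bump t * bump (interface t))
      \<le> norm (indicator {0..1} t :: real)"
    by (intro AE_I2) simp
qed simp

lemma cell_variation_pos: "cell_variation > 0"
proof -
  let ?f = "\<lambda>t. t * bump t * bump (interface t)"
  have nonneg: "?f t \<ge> 0" for t
    using bump_bounds[of t] bump_bounds[of "interface t"] bump_eq_0(1)[of t]
    by (cases "t \<in> {0<..<1/2}") (auto simp: zero_le_mult_iff)
  then have "cell_variation \<ge> 0" by (simp add: cell_variation_def)
  moreover have "cell_variation \<noteq> 0"
  proof
    assume "cell_variation = 0"
    then have "AE t in lborel. ?f t = 0"
      unfolding cell_variation_def
      using integral_nonneg_eq_0_iff_AE[OF integrable_cell_variation] nonneg by simp
    then have "AE t in lborel. t \<notin> {0<..<1/2 :: real}"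
    proof eventually_elim
      case (elim t)
      then show ?case
        using bump_pos[of t] bump_pos[OF interface_less, of t] by auto
    qed
    then have "{0<..<1/2 :: real} \<in> null_sets lborel"
      by (simp add: AE_iff_null_sets)
    then show False by (simp add: null_sets_def)
  qed
  ultimately show ?thesis by simp
qed

lemma integral_bump'_right:
  assumes "a > 0" "k \<ge> 0"
  shows "(LINT s|lborel. (if k < s then bump' (s / a) / a else 0)) = - bump (k / a)"
proof -
  have "(LINT s|lborel. (if k < s then bump' (s / a) / a else 0))
      = (LINT s|lborel. bump' (s / a) / a * indicator {k..k + a} s)"
  proof (rule integral_cong_AE)
    have "AE s in lborel. s \<noteq> k" by (rule AE_lborel_singleton)
    then show "AE s in lborel. (if k < s then bump' (s / a) / a else 0)
        = bump' (s / a) / a * indicator {k..k + a} s"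
    proof eventually_elim
      case (elim s)
      have "bump' (s / a) = 0" if "s > k + a"
        using that assms by (intro bump_eq_0) (auto simp: field_simps)
      then show ?case using elim by (auto simp: indicator_def)
    qed
  qed measurable
  also have "\<dots> = bump ((k + a) / a) - bump (k / a)"
  proof (rule integral_FTC_Icc_real)
    show "((\<lambda>s. bump (s / a)) has_real_derivative bump' (s / a) / a) (at s)" for s
    proof -
      have "((\<lambda>s. s / a) has_real_derivative 1 / a) (at s)"
        using assms by (auto intro!: derivative_eq_intros)
      from DERIV_chain2[where f = bump, OF has_derivative_bump this] show ?thesis by simp
    qed
    show "isCont (\<lambda>s. bump' (s / a) / a) s" for s
      using continuous_bump'[of UNIV] assms
      by (intro continuous_intros continuous_at_compose[unfolded o_def, of s "\<lambda>s. s / a" bump'])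
        (auto simp: continuous_on_eq_continuous_at)
  qed (use assms in simp)
  also have "bump ((k + a) / a) = 0"
    using assms by (intro bump_eq_0) (auto simp: field_simps)
  finally show ?thesis by simp
qed

text \<open>The scale \<open>e\<close> enters only through \<open>h\<^sup>2 = e\<close> to the fourth, since \<open>interface (e\<^sup>2 t)\<close> equals
  \<open>e\<^sup>3\<close> times \<open>interface t\<close>. The values of \<open>g\<close> on the interface are irrelevant.\<close>

lemma integral_cell:
  fixes z :: "real^2" and g :: "real^2 \<Rightarrow> real"
  assumes e: "e > 0"
    and a: "a = e^3" and h: "h = e\<^sup>2"
    and meas: "(\<lambda>x. g x * frechet_derivative (cell_bump z a h) (at x) (axis 1 1))
      \<in> borel_measurable lebesgue"
    and right: "\<And>x. x \<in> box z (vector [z $ 1 + a / 2, z $ 2 + h / 2]) \<Longrightarrow>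
      x $ 1 - z $ 1 > interface (x $ 2 - z $ 2) \<Longrightarrow> g x = c * (x $ 2 - z $ 2)"
    and left: "\<And>x. x \<in> box z (vector [z $ 1 + a / 2, z $ 2 + h / 2]) \<Longrightarrow>
      x $ 1 - z $ 1 < interface (x $ 2 - z $ 2) \<Longrightarrow> g x = 0"
  shows "(LINT x|lebesgue. g x * frechet_derivative (cell_bump z a h) (at x) (axis 1 1))
    = - (c * h\<^sup>2 * cell_variation)"
proof -
  have pos: "a > 0" "h > 0" using e by (simp_all add: a h)
  define b where "b t = c * (t - z $ 2) * bump ((t - z $ 2) / h)" for t
  define f where "f s t = (if interface (t - z $ 2) < s - z $ 1 then bump' ((s - z $ 1) / a) / a else 0) * b t"
    for s t
  have D: "frechet_derivative (cell_bump z a h) (at x) (axis 1 1)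
      = bump' ((x $ 1 - z $ 1) / a) / a * bump ((x $ 2 - z $ 2) / h)" for x
    using pos(1) by (rule frechet_derivative_cell_bump)
  have b_meas [measurable]: "b \<in> borel_measurable borel" unfolding b_def by measurable
  have f_meas: "(\<lambda>(s, t). f s t) \<in> borel_measurable (lborel \<Otimes>\<^sub>M lborel)"
    unfolding f_def by measurable
  have f_int: "integrable (lborel \<Otimes>\<^sub>M lborel) (\<lambda>(s, t). f s t)"
  proof -
    obtain M where M: "\<And>t. \<bar>bump' t\<bar> \<le> M" using bump'_bounded by blast
    then have M0: "M \<ge> 0" by (meson abs_ge_zero order_trans)
    let ?R = "{z $ 1..z $ 1 + a} \<times> {z $ 2..z $ 2 + h}"
    have bound: "\<bar>f s t\<bar> \<le> M / a * (\<bar>c\<bar> * h) * indicator ?R (s, t)" for s t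
    proof (cases "(s - z $ 1) / a \<in> {0<..<1/2} \<and> (t - z $ 2) / h \<in> {0<..<1/2}")
      case True
      then have R: "(s, t) \<in> ?R" and t: "\<bar>t - z $ 2\<bar> \<le> h"
        using pos by (auto simp: field_simps)
      have "\<bar>b t\<bar> = \<bar>c\<bar> * \<bar>t - z $ 2\<bar> * bump ((t - z $ 2) / h)"
        using bump_bounds by (simp add: b_def abs_mult)
      also have "\<dots> \<le> \<bar>c\<bar> * h * 1"
        using t bump_bounds pos by (intro mult_mono) auto
      finally have "\<bar>b t\<bar> \<le> \<bar>c\<bar> * h" by simp
      moreover have "\<bar>if interface (t - z $ 2) < s - z $ 1 then bump' ((s - z $ 1) / a) / a else 0\<bar> \<le> M / a"
        using M M0 pos by (auto simp: divide_right_mono)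
      ultimately have "\<bar>f s t\<bar> \<le> M / a * (\<bar>c\<bar> * h)"
        unfolding f_def abs_mult using M0 pos by (intro mult_mono) auto
      with R show ?thesis by simp
    next
      case False
      then have "f s t = 0"
        by (auto simp: f_def b_def bump_eq_0)
      then show ?thesis using M0 pos by simp
    qed
    show ?thesis
    proof (rule Bochner_Integration.integrable_bound)
      show "integrable (lborel \<Otimes>\<^sub>M lborel) (\<lambda>z. M / a * (\<bar>c\<bar> * h) * indicator ?R z)"
        using pos by (intro integrable_mult_right integrable_real_indicator)
          (auto simp: lborel.emeasure_pair_measure_Times ennreal_mult_less_top)
      show "AE z in lborel \<Otimes>\<^sub>M lborel. norm (case z of (s, t) \<Rightarrow> f s t)
          \<le> norm (M / a * (\<bar>c\<bar> * h) * indicator ?R z)"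
        using bound M0 pos by (intro AE_I2) (auto simp: abs_mult)
    qed (fact f_meas)
  qed
  have "(LINT x|lebesgue. g x * frechet_derivative (cell_bump z a h) (at x) (axis 1 1))
      = (LINT x|lebesgue. f ((x :: real^2) $ 1) (x $ 2))"
  proof (rule integral_cong_AE[OF meas])
    have "(\<lambda>x::real^2. (x $ 1, x $ 2)) \<in> measurable borel (lborel \<Otimes>\<^sub>M lborel)"
      by (intro measurable_Pair) (auto intro!: borel_measurable_continuous_onI continuous_intros)
    from measurable_compose[OF this f_meas]
    show "(\<lambda>x::real^2. f (x $ 1) (x $ 2)) \<in> borel_measurable lebesgue"
      by (intro measurable_completion) simp
    have "AE x in lebesgue. (x :: real^2) $ 1 \<noteq> z $ 1 + interface (x $ 2 - z $ 2)"
      by (rule AE_not_on_graph) measurable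
    then show "AE x in lebesgue. g x * frechet_derivative (cell_bump z a h) (at x) (axis 1 1)
        = f (x $ 1) (x $ 2)"
    proof eventually_elim
      case (elim x)
      show ?case
      proof (cases "x \<in> box z (vector [z $ 1 + a / 2, z $ 2 + h / 2])")
        case True
        then show ?thesis
          using elim right[of x] left[of x]
          by (cases "interface (x $ 2 - z $ 2) < x $ 1 - z $ 1") (auto simp: D f_def b_def)
      next
        case False
        then have "(x $ 1 - z $ 1) / a \<notin> {0<..<1/2} \<or> (x $ 2 - z $ 2) / h \<notin> {0<..<1/2}"
          using pos by (auto simp: mem_box_cart forall_2 field_simps)
        then show ?thesis by (auto simp: D f_def b_def bump_eq_0)
      qed
    qed
  qed
  also have "\<dots> = (LINT t|lborel. LINT s|lborel. f s t)"
    by (rule integral_lebesgue_plane[OF f_meas f_int])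
  also have "\<dots> = (LINT t|lborel. - (b t * bump (interface (t - z $ 2) / a)))"
  proof (rule Bochner_Integration.integral_cong[OF refl])
    fix t
    have "(LINT s|lborel. f s t)
        = (LINT s|lborel. (if interface (t - z $ 2) < s then bump' (s / a) / a else 0)) * b t"
      by (subst lborel_integral_real_affine[of 1 _ "z $ 1"]) (simp_all add: f_def cong: if_cong)
    also have "\<dots> = - (b t * bump (interface (t - z $ 2) / a))"
    proof (cases "t \<ge> z $ 2")
      case True
      then show ?thesis
        using integral_bump'_right[OF pos(1) interface_nonneg, of "t - z $ 2"] by simp
    next
      case False
      then have "(t - z $ 2) / h \<notin> {0<..<1/2}" using pos by (simp add: field_simps)
      then have "b t = 0" by (simp add: b_def bump_eq_0)
      then show ?thesis by simp
    qed
    finally show "(LINT s|lborel. f s t) = - (b t * bump (interface (t - z $ 2) / a))" .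
  qed
  also have "\<dots> = h * (LINT t|lborel. - (b (z $ 2 + h * t) * bump (interface (h * t) / a)))"
    using pos by (subst lborel_integral_real_affine[of h _ "z $ 2"]) simp_all
  also have "(\<lambda>t. - (b (z $ 2 + h * t) * bump (interface (h * t) / a)))
      = (\<lambda>t. - (c * h) * (t * bump t * bump (interface t)))"
    using interface_scale[of e] e by (auto simp: b_def h a)
  also have "h * (LINT t|lborel. - (c * h) * (t * bump t * bump (interface t)))
      = - (c * h\<^sup>2 * cell_variation)"
    by (simp add: cell_variation_def power2_eq_square)
  finally show ?thesis .
qed

section \<open>Failure of locally bounded variation\<close>

lemma node_in_0_2:
  assumes "k \<ge> 1" "i < 2 ^ ((k - 1) * n)"
  shows "0 \<le> node k n i" "node k n i + 1 / 2 ^ (k * n) \<le> 2"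
proof -
  have "(2::real) / 2 ^ n \<le> 2 / 1" by (intro divide_left_mono) auto
  then show "node k n i + 1 / 2 ^ (k * n) \<le> 2"
    using node_bounds(2)[OF assms(1), of "Suc i" n] assms(2) unfolding node_Suc by linarith
  show "0 \<le> node k n i" by (simp add: node_def)
qed

lemma cell_subset:
  assumes "i < 2 ^ (8 * n)" "j < 2 ^ (5 * n)"
  shows "cell n i j \<subseteq> cbox 0 (vector [2, 2])"
proof
  fix x assume "x \<in> cell n i j"
  moreover have "(0::real) < 1 / 2 ^ (9 * n)" "(0::real) < 1 / 2 ^ (6 * n)" by simp_all
  ultimately show "x \<in> cbox 0 (vector [2, 2])"
    using node_in_0_2[of 9 i n] node_in_0_2[of 6 j n] assms
    by (simp add: mem_cell mem_box_cart forall_2)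
qed

lemma disjoint_node_intervals:
  assumes "i \<noteq> i'" "node k n i < s" "s < node k n i + 1 / 2 ^ (k * n) / 2"
    "node k n i' < s" "s < node k n i' + 1 / 2 ^ (k * n) / 2"
  shows False
proof -
  have "(0::real) < 1 / 2 ^ (k * n)" by simp
  then show False
    using assms node_mono[of "Suc i" i' k n] node_mono[of "Suc i'" i k n] unfolding node_Suc
    by (cases i i' rule: linorder_cases) auto
qed

lemma disjoint_cells: "disjoint_family_on (\<lambda>(i, j). cell n i j) S"
  unfolding disjoint_family_on_def
proof (intro ballI impI)
  fix p q :: "nat \<times> nat"
  assume "p \<noteq> q"
  obtain i j i' j' where pq: "p = (i, j)" "q = (i', j')" by fastforce
  have False if "x \<in> cell n i j" "x \<in> cell n i' j'" for x
    using that \<open>p \<noteq> q\<close> disjoint_node_intervals[of i i' 9 n "x $ 1"]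
      disjoint_node_intervals[of j j' 6 n "x $ 2"]
    by (auto simp: mem_cell pq)
  then show "(case p of (i, j) \<Rightarrow> cell n i j) \<inter> (case q of (i, j) \<Rightarrow> cell n i j) = {}"
    by (auto simp: pq)
qed

text \<open>If \<open>D\<^sub>1 V\<^sub>2\<close> were \<open>\<mu> - \<nu>\<close>, then \<open>\<mu>\<close> would have mass at least a constant times
  \<open>h\<^sup>2\<close> in each of the disjoint cells of scale \<open>n\<close>. Their number exceeds \<open>1 / h\<^sup>2\<close> by the factor
  \<open>2\<close> to the power \<open>n\<close>, contradicting finiteness on a square.\<close>

lemma not_locally_BV_if_cells:
  fixes V :: "real^2 \<Rightarrow> real^2"
  assumes c: "c > 0"
    and right: "\<And>n i j x. i < 2 ^ (8 * n) \<Longrightarrow> j < 2 ^ (5 * n) \<Longrightarrow> x \<in> cell n i j \<Longrightarrow>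
      x $ 1 - node 9 n i > interface (x $ 2 - node 6 n j) \<Longrightarrow> V x $ 2 = c * (x $ 2 - node 6 n j)"
    and left: "\<And>n i j x. i < 2 ^ (8 * n) \<Longrightarrow> j < 2 ^ (5 * n) \<Longrightarrow> x \<in> cell n i j \<Longrightarrow>
      x $ 1 - node 9 n i < interface (x $ 2 - node 6 n j) \<Longrightarrow> V x $ 2 = 0"
  shows "\<not> locally_BV V"
proof
  assume BV: "locally_BV V"
  define K :: "(real^2) set" where "K = cbox 0 (vector [2, 2])"
  have K: "compact K" by (simp add: K_def compact_cbox)
  then have "V absolutely_integrable_on K"
    using BV unfolding locally_BV_def by blast
  then have V_meas: "(\<lambda>x. indicator K x *\<^sub>R V x) \<in> borel_measurable lebesgue"
    unfolding set_integrable_def by (rule borel_measurable_integrable)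
  obtain \<mu> \<nu> :: "(real^2) measure" where \<mu>: "radon_measure \<mu>" and \<nu>: "radon_measure \<nu>"
    and parts: "\<And>\<phi>. test_function \<phi> \<Longrightarrow>
      (LINT x|lebesgue. V x $ 2 * frechet_derivative \<phi> (at x) (axis 1 1)) =
        - ((LINT x|\<mu>. \<phi> x) - (LINT x|\<nu>. \<phi> x))"
    using BV unfolding locally_BV_def by blast
  have [measurable_cong]: "sets \<mu> = sets borel" using \<mu> by (simp add: radon_measure_def)
  have finite_K: "emeasure \<mu> K < \<infinity>" using \<mu> K by (simp add: radon_measure_def)
  have K_sets: "K \<in> sets \<mu>" by (simp add: K_def)
  have mass: "c * cell_variation / 2 ^ (12 * n) \<le> measure \<mu> (cell n i j)"
    if ij: "i < 2 ^ (8 * n)" "j < 2 ^ (5 * n)" for n i j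
  proof -
    define z :: "real^2" where "z = vector [node 9 n i, node 6 n j]"
    define e a h :: real where "e = 1 / 2 ^ (3 * n)" and "a = 1 / 2 ^ (9 * n)" and "h = 1 / 2 ^ (6 * n)"
    have e: "e > 0" "a = e^3" "h = e\<^sup>2" and pos: "a > 0" "h > 0"
      by (simp_all add: e_def a_def h_def power_divide mult.commute flip: power_mult)
    have cell: "cell n i j = box z (vector [z $ 1 + a / 2, z $ 2 + h / 2])"
      by (simp add: cell_def z_def a_def h_def)
    let ?\<phi> = "cell_bump z a h"
    have outside: "?\<phi> x = 0" if "x \<notin> cell n i j" for x
      using cell_bump_eq_0[OF pos, of x z] that cell by simp
    have D_outside: "frechet_derivative ?\<phi> (at x) (axis 1 1) = 0" if "x \<notin> K" for x
    proof -
      have "x \<notin> cell n i j" using that cell_subset[OF ij] by (auto simp: K_def)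
      then have "(x $ 1 - z $ 1) / a \<notin> {0<..<1/2} \<or> (x $ 2 - z $ 2) / h \<notin> {0<..<1/2}"
        using pos by (auto simp: cell mem_box_cart forall_2 field_simps)
      then show ?thesis
        by (auto simp: frechet_derivative_cell_bump[OF pos(1)] bump_eq_0)
    qed
    have "(\<lambda>x. frechet_derivative ?\<phi> (at x) (axis 1 1)) \<in> borel_measurable borel"
      unfolding frechet_derivative_cell_bump[OF pos(1)]
      by (intro borel_measurable_continuous_onI continuous_intros
          continuous_on_compose2[OF continuous_bump[of UNIV]]
          continuous_on_compose2[OF continuous_bump'[of UNIV]]) (use pos in auto)
    then have D_meas: "(\<lambda>x. frechet_derivative ?\<phi> (at x) (axis 1 1)) \<in> borel_measurable lebesgue"
      by (intro measurable_completion) simp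
    have "(\<lambda>x. (indicator K x *\<^sub>R V x) $ 2 * frechet_derivative ?\<phi> (at x) (axis 1 1))
        \<in> borel_measurable lebesgue"
      by (intro borel_measurable_times D_meas measurable_compose[OF V_meas]
          borel_measurable_continuous_onI continuous_intros)
    also have "(\<lambda>x. (indicator K x *\<^sub>R V x) $ 2 * frechet_derivative ?\<phi> (at x) (axis 1 1))
        = (\<lambda>x. V x $ 2 * frechet_derivative ?\<phi> (at x) (axis 1 1))"
    proof
      fix x
      show "(indicator K x *\<^sub>R V x) $ 2 * frechet_derivative ?\<phi> (at x) (axis 1 1)
          = V x $ 2 * frechet_derivative ?\<phi> (at x) (axis 1 1)"
        using D_outside[of x] by (cases "x \<in> K") auto
    qed
    finally have "(LINT x|lebesgue. V x $ 2 * frechet_derivative ?\<phi> (at x) (axis 1 1))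
        = - (c * h\<^sup>2 * cell_variation)"
    proof (rule integral_cell[OF e])
      fix x
      assume "x \<in> box z (vector [z $ 1 + a / 2, z $ 2 + h / 2])"
      then have x: "x \<in> cell n i j" by (simp only: cell)
      show "V x $ 2 = c * (x $ 2 - z $ 2)" if "interface (x $ 2 - z $ 2) < x $ 1 - z $ 1"
        using right[OF ij x] that by (simp add: z_def)
      show "V x $ 2 = 0" if "x $ 1 - z $ 1 < interface (x $ 2 - z $ 2)"
        using left[OF ij x] that by (simp add: z_def)
    qed
    with parts[OF test_function_cell_bump[OF pos], of z]
    have "(LINT x|\<mu>. ?\<phi> x) = c * h\<^sup>2 * cell_variation + (LINT x|\<nu>. ?\<phi> x)"
      by simp
    moreover have "(LINT x|\<nu>. ?\<phi> x) \<ge> 0"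
      by (intro integral_nonneg_AE AE_I2 cell_bump_bounds)
    moreover have "(LINT x|\<mu>. ?\<phi> x) \<le> measure \<mu> (cell n i j)"
    proof -
      have sets: "cell n i j \<in> sets \<mu>" by (simp add: cell_def)
      have "emeasure \<mu> (cell n i j) \<le> emeasure \<mu> K"
        using cell_subset[OF ij] K_sets by (intro emeasure_mono) (auto simp: K_def)
      with finite_K have "emeasure \<mu> (cell n i j) < \<infinity>" by (rule le_less_trans[rotated])
      then have "integrable \<mu> (indicator (cell n i j) :: _ \<Rightarrow> real)"
        using sets by (intro integrable_real_indicator)
      then have "(LINT x|\<mu>. ?\<phi> x) \<le> (LINT x|\<mu>. indicator (cell n i j) x)"
      proof (rule integral_mono')
        show "?\<phi> x \<le> indicator (cell n i j) x" for x
          using outside[of x] cell_bump_bounds(2) by (cases "x \<in> cell n i j") auto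
      qed simp
      then show ?thesis using sets by simp
    qed
    moreover have "h\<^sup>2 = 1 / 2 ^ (12 * n)"
      by (simp add: h_def power_divide mult.commute flip: power_mult)
    ultimately show ?thesis by simp
  qed
  have "2 ^ n * (c * cell_variation) \<le> measure \<mu> K" for n
  proof -
    let ?S = "{..<2 ^ (8 * n)} \<times> {..<2 ^ (5 * n)} :: (nat \<times> nat) set"
    have "2 ^ n * (c * cell_variation) = (\<Sum>(i, j)\<in>?S. c * cell_variation / 2 ^ (12 * n))"
      by (simp add: case_prod_unfold card_cartesian_product flip: power_add)
        (simp add: field_simps flip: power_add)
    also have "\<dots> \<le> (\<Sum>(i, j)\<in>?S. measure \<mu> (cell n i j))"
      using mass by (intro sum_mono) auto
    also have "\<dots> = (\<Sum>p\<in>?S. measure \<mu> ((\<lambda>(i, j). cell n i j) p))"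
      by (simp add: case_prod_unfold)
    also have "\<dots> = measure \<mu> (\<Union>p\<in>?S. (\<lambda>(i, j). cell n i j) p)"
    proof (rule measure_finite_Union[symmetric])
      show "emeasure \<mu> (case p of (i, j) \<Rightarrow> cell n i j) \<noteq> \<infinity>" if "p \<in> ?S" for p
      proof -
        have "emeasure \<mu> (case p of (i, j) \<Rightarrow> cell n i j) \<le> emeasure \<mu> K"
          using that cell_subset K_sets by (intro emeasure_mono) (auto simp: K_def)
        with finite_K show ?thesis by (auto simp: top_unique)
      qed
      show "disjoint_family_on (\<lambda>(i, j). cell n i j) ?S" by (rule disjoint_cells)
    qed (auto simp: cell_def)
    also have "\<dots> \<le> measure \<mu> K"
      using cell_subset K_sets finite_K
      by (intro measure_mono_fmeasurable) (auto simp: K_def cell_def fmeasurable_def)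
    finally show ?thesis .
  qed
  moreover obtain n where "measure \<mu> K / (c * cell_variation) < 2 ^ n"
    using real_arch_pow[of 2] by auto
  ultimately show False
    using c cell_variation_pos by (smt (verit) mult_pos_pos pos_divide_less_eq)
qed

theorem mainTheorem4:
  fixes H :: "real^2 \<Rightarrow> real"
  assumes H_def: "\<And>p. H p = 3^3 / 4^4 * (p $ 1)^4 + (p $ 2)^2"
  shows "smooth H \<and> strictly_convex H \<and> coercive H \<and> \<not> uniformly_directionally_convex H \<and>
    (\<exists>u0 :: real^2 \<Rightarrow> real. (\<exists>C. C-lipschitz_on UNIV u0) \<and>
      (\<exists>u. u = hopf_lax H u0 \<and> viscosity_solution H u0 u \<and>
        \<not> locally_BV (grad (u 1)) \<and>
        \<not> locally_BV (\<lambda>x. grad H (grad (u 1) x))))"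
proof -
  have H: "H = hamiltonian"
    by (rule ext) (simp add: H_def hamiltonian_def)
  define u0 where "u0 = grid_datum (comb 9) (comb 6)"
  interpret hopf_lax_datum hamiltonian u0 2
    by unfold_locales (simp add: u0_def lipschitz_grid_datum)
  have u1: "hopf_lax hamiltonian u0 1 = u1"
    by (simp add: u0_def u1_def)
  have "\<not> locally_BV (grad u1)"
    by (rule not_locally_BV_if_cells[of "1 / 2"])
      (simp_all add: grad_u1_cell)
  moreover have "\<not> locally_BV (\<lambda>x. grad hamiltonian (grad u1 x))"
    by (rule not_locally_BV_if_cells[of 1])
      (simp_all add: grad_u1_cell grad_hamiltonian)
  ultimately show ?thesis
    unfolding H
    using smooth_hamiltonian strictly_convex_hamiltonian coercive_hamiltonian
      not_uniformly_directionally_convex_hamiltonian lipschitz hopf_lax_viscosity_solution u1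
    by metis
qed

end
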